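(* Let $R$ be a Dedekind domain and let $I$ be a nonzero ideal of $R$ such that $R/I$ is finite and nontrivial. Let $m$ be a positive integer and suppose $I$ has exactly $m$ distinct prime ideal divisors $P$ with $|R/P|=2$. Then $G_{R/I}$ has exactly $2^{m-1}$ connected components, and these components are bipartite graphs, pairwise isomorphic, each of diameter at most $3$.
   Context: $G_{R/I}$ is the unitary Cayley graph of $R/I$: vertex set $R/I$, with $a+I$, $b+I$ adjacent iff $a-b+I$ is a unit of $R/I$. *)

theory Defs
  imports
    "Graph_Theory.Digraph_Component"
    "Graph_Theory.Digraph_Isomorphism"
    "Graph_Theory.Shortest_Path"
    "HOL-Algebra.Algebra"
begin

section \<open>Dedekind domains\<close>

definition fraction :: "('a, 'b) ring_scheme \<Rightarrow> 'a \<Rightarrow> 'a \<Rightarrow> ('a \<times> 'a) set" where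
  "fraction R a b = {(c, d). c \<in> carrier R \<and> d \<in> carrier R - {\<zero>\<^bsub>R\<^esub>} \<and>
     a \<otimes>\<^bsub>R\<^esub> d = c \<otimes>\<^bsub>R\<^esub> b}"

text \<open>The operations on classes are unions over representatives, in the style of
  \<^const>\<open>rcoset_mult\<close>; see \<open>fraction_mult\<close> and \<open>fraction_add\<close> below.\<close>

definition fraction_field :: "('a, 'b) ring_scheme \<Rightarrow> ('a \<times> 'a) set ring" where
  "fraction_field R =
    \<lparr>carrier = {fraction R a b | a b. a \<in> carrier R \<and> b \<in> carrier R - {\<zero>\<^bsub>R\<^esub>}},
     monoid.mult = (\<lambda>A B. \<Union>(a, b)\<in>A. \<Union>(c, d)\<in>B. fraction R (a \<otimes>\<^bsub>R\<^esub> c) (b \<otimes>\<^bsub>R\<^esub> d)),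
     one = fraction R \<one>\<^bsub>R\<^esub> \<one>\<^bsub>R\<^esub>,
     ring.zero = fraction R \<zero>\<^bsub>R\<^esub> \<one>\<^bsub>R\<^esub>,
     add = (\<lambda>A B. \<Union>(a, b)\<in>A. \<Union>(c, d)\<in>B.
       fraction R (a \<otimes>\<^bsub>R\<^esub> d \<oplus>\<^bsub>R\<^esub> c \<otimes>\<^bsub>R\<^esub> b) (b \<otimes>\<^bsub>R\<^esub> d))\<rparr>"

text \<open>The image of \<open>R\<close> in its fraction field.\<close>

definition fraction_base :: "('a, 'b) ring_scheme \<Rightarrow> ('a \<times> 'a) set set" where
  "fraction_base R = (\<lambda>a. fraction R a \<one>\<^bsub>R\<^esub>) ` carrier R"

definition integral_over :: "('a, 'b) ring_scheme \<Rightarrow> 'a set \<Rightarrow> 'a \<Rightarrow> bool" where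
  "integral_over K S x \<longleftrightarrow>
     (\<exists>p \<in> carrier (S[X]\<^bsub>K\<^esub>). p \<noteq> [] \<and> lead_coeff p = \<one>\<^bsub>K\<^esub> \<and> ring.eval K p x = \<zero>\<^bsub>K\<^esub>)"

text \<open>Fields count as Dedekind domains here.\<close>

locale dedekind_domain = noetherian_domain +
  assumes integrally_closed:
      "\<lbrakk>x \<in> carrier (fraction_field R); integral_over (fraction_field R) (fraction_base R) x\<rbrakk>
        \<Longrightarrow> x \<in> fraction_base R"
    and prime_imp_maximal: "\<lbrakk>primeideal P R; P \<noteq> {\<zero>}\<rbrakk> \<Longrightarrow> maximalideal P R"

definition ideal_dvd :: "('a, 'b) ring_scheme \<Rightarrow> 'a set \<Rightarrow> 'a set \<Rightarrow> bool" where
  "ideal_dvd R P I \<longleftrightarrow> (\<exists>J. ideal J R \<and> I = P \<cdot>\<^bsub>R\<^esub> J)"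

subsection \<open>The fraction field of a domain is a field\<close>

lemma UN_pairs_const:
  assumes "p \<in> A" "q \<in> B"
    and "\<And>a b c d. \<lbrakk>(a, b) \<in> A; (c, d) \<in> B\<rbrakk> \<Longrightarrow> f a b c d = r"
  shows "(\<Union>(a, b)\<in>A. \<Union>(c, d)\<in>B. f a b c d) = r"
  using assms by (cases p; cases q) (fastforce)

context domain
begin

lemma fraction_self:
  "\<lbrakk>a \<in> carrier R; b \<in> carrier R - {\<zero>}\<rbrakk> \<Longrightarrow> (a, b) \<in> fraction R a b"
  by (simp add: fraction_def)

lemma fraction_eq_iff:
  assumes "a \<in> carrier R" "b \<in> carrier R - {\<zero>}" "c \<in> carrier R" "d \<in> carrier R - {\<zero>}"
  shows "fraction R a b = fraction R c d \<longleftrightarrow> a \<otimes> d = c \<otimes> b"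
proof
  assume "fraction R a b = fraction R c d"
  then have "(c, d) \<in> fraction R a b" using fraction_self assms by simp
  then show "a \<otimes> d = c \<otimes> b" by (simp add: fraction_def)
next
  assume eq: "a \<otimes> d = c \<otimes> b"
  have "a \<otimes> y = x \<otimes> b \<longleftrightarrow> c \<otimes> y = x \<otimes> d" if xy: "x \<in> carrier R" "y \<in> carrier R - {\<zero>}" for x y
  proof -
    have "a \<otimes> y = x \<otimes> b \<longleftrightarrow> d \<otimes> (a \<otimes> y) = d \<otimes> (x \<otimes> b)"
      using assms xy m_lcancel[of d "a \<otimes> y" "x \<otimes> b"] by auto
    also have "d \<otimes> (a \<otimes> y) = b \<otimes> (c \<otimes> y)"
    proof -
      have "d \<otimes> (a \<otimes> y) = (a \<otimes> d) \<otimes> y" using assms xy by (simp add: m_ac)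
      also have "\<dots> = b \<otimes> (c \<otimes> y)" using assms xy by (simp add: eq m_ac)
      finally show ?thesis .
    qed
    also have "d \<otimes> (x \<otimes> b) = b \<otimes> (x \<otimes> d)" using assms xy by (simp add: m_ac)
    also have "b \<otimes> (c \<otimes> y) = b \<otimes> (x \<otimes> d) \<longleftrightarrow> c \<otimes> y = x \<otimes> d"
      using assms xy m_lcancel[of b "c \<otimes> y" "x \<otimes> d"] by auto
    finally show ?thesis .
  qed
  then show "fraction R a b = fraction R c d" by (auto simp: fraction_def)
qed

lemma fraction_closed:
  "\<lbrakk>a \<in> carrier R; b \<in> carrier R - {\<zero>}\<rbrakk> \<Longrightarrow> fraction R a b \<in> carrier (fraction_field R)"
  by (auto simp: fraction_field_def)

lemma nonzero_mult: "\<lbrakk>b \<in> carrier R - {\<zero>}; d \<in> carrier R - {\<zero>}\<rbrakk> \<Longrightarrow> b \<otimes> d \<in> carrier R - {\<zero>}"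
  using integral by auto

lemma fraction_mult:
  assumes "a \<in> carrier R" "b \<in> carrier R - {\<zero>}" "c \<in> carrier R" "d \<in> carrier R - {\<zero>}"
  shows "fraction R a b \<otimes>\<^bsub>fraction_field R\<^esub> fraction R c d = fraction R (a \<otimes> c) (b \<otimes> d)"
proof -
  have *: "fraction R (a' \<otimes> c') (b' \<otimes> d') = fraction R (a \<otimes> c) (b \<otimes> d)"
    if "(a', b') \<in> fraction R a b" "(c', d') \<in> fraction R c d" for a' b' c' d'
  proof -
    from that have c: "a' \<in> carrier R" "b' \<in> carrier R - {\<zero>}" "c' \<in> carrier R" "d' \<in> carrier R - {\<zero>}"
      and e: "a \<otimes> b' = a' \<otimes> b" "c \<otimes> d' = c' \<otimes> d"
      by (auto simp: fraction_def)
    have "(a' \<otimes> c') \<otimes> (b \<otimes> d) = (a' \<otimes> b) \<otimes> (c' \<otimes> d)" using assms c by (simp add: m_ac)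
    also have "\<dots> = (a \<otimes> b') \<otimes> (c \<otimes> d')" by (simp add: e)
    also have "\<dots> = (a \<otimes> c) \<otimes> (b' \<otimes> d')" using assms c by (simp add: m_ac)
    finally show ?thesis
      using assms c nonzero_mult by (subst fraction_eq_iff) auto
  qed
  show ?thesis
    using fraction_self[OF assms(1,2)] fraction_self[OF assms(3,4)]
    by (simp add: fraction_field_def) (rule UN_pairs_const, assumption, assumption, rule *)
qed

lemma fraction_add:
  assumes "a \<in> carrier R" "b \<in> carrier R - {\<zero>}" "c \<in> carrier R" "d \<in> carrier R - {\<zero>}"
  shows "fraction R a b \<oplus>\<^bsub>fraction_field R\<^esub> fraction R c d = fraction R (a \<otimes> d \<oplus> c \<otimes> b) (b \<otimes> d)"
proof -
  have *: "fraction R (a' \<otimes> d' \<oplus> c' \<otimes> b') (b' \<otimes> d') = fraction R (a \<otimes> d \<oplus> c \<otimes> b) (b \<otimes> d)"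
    if "(a', b') \<in> fraction R a b" "(c', d') \<in> fraction R c d" for a' b' c' d'
  proof -
    from that have c: "a' \<in> carrier R" "b' \<in> carrier R - {\<zero>}" "c' \<in> carrier R" "d' \<in> carrier R - {\<zero>}"
      and e: "a \<otimes> b' = a' \<otimes> b" "c \<otimes> d' = c' \<otimes> d"
      by (auto simp: fraction_def)
    have "(a' \<otimes> d' \<oplus> c' \<otimes> b') \<otimes> (b \<otimes> d) = (a' \<otimes> b) \<otimes> (d' \<otimes> d) \<oplus> (c' \<otimes> d) \<otimes> (b' \<otimes> b)"
      using assms c by (simp add: m_ac l_distr r_distr)
    also have "\<dots> = (a \<otimes> b') \<otimes> (d' \<otimes> d) \<oplus> (c \<otimes> d') \<otimes> (b' \<otimes> b)" by (simp add: e)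
    also have "\<dots> = (a \<otimes> d \<oplus> c \<otimes> b) \<otimes> (b' \<otimes> d')" using assms c by (simp add: m_ac l_distr r_distr)
    finally show ?thesis
      using assms c nonzero_mult by (subst fraction_eq_iff) auto
  qed
  show ?thesis
    using fraction_self[OF assms(1,2)] fraction_self[OF assms(3,4)]
    by (simp add: fraction_field_def) (rule UN_pairs_const, assumption, assumption, rule *)
qed

lemma fraction_one: "\<one>\<^bsub>fraction_field R\<^esub> = fraction R \<one> \<one>"
  and fraction_zero: "\<zero>\<^bsub>fraction_field R\<^esub> = fraction R \<zero> \<one>"
  by (simp_all add: fraction_field_def)

lemma fraction_cases:
  assumes "x \<in> carrier (fraction_field R)"
  obtains a b where "x = fraction R a b" "a \<in> carrier R" "b \<in> carrier R - {\<zero>}"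
  using assms by (auto simp: fraction_field_def)

lemma one_nonzero: "\<one> \<in> carrier R - {\<zero>}"
  by simp

lemma fraction_field_is_field: "field (fraction_field R)"
proof -
  let ?F = "fraction_field R"
  note closed = fraction_closed nonzero_mult one_nonzero
  note ops = fraction_mult fraction_add fraction_one fraction_zero
  have ag: "abelian_group ?F"
  proof (rule abelian_groupI)
    fix x y z assume xyz: "x \<in> carrier ?F" "y \<in> carrier ?F" "z \<in> carrier ?F"
    from xyz(1) obtain a b where x: "x = fraction R a b" "a \<in> carrier R" "b \<in> carrier R - {\<zero>}"
      by (rule fraction_cases)
    from xyz(2) obtain c d where y: "y = fraction R c d" "c \<in> carrier R" "d \<in> carrier R - {\<zero>}"
      by (rule fraction_cases)
    from xyz(3) obtain e f where z: "z = fraction R e f" "e \<in> carrier R" "f \<in> carrier R - {\<zero>}"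
      by (rule fraction_cases)
    show "x \<oplus>\<^bsub>?F\<^esub> y \<in> carrier ?F"
      using x y nonzero_mult[of b d] by (auto simp: fraction_add intro!: fraction_closed)
    show "x \<oplus>\<^bsub>?F\<^esub> y = y \<oplus>\<^bsub>?F\<^esub> x"
      using x y by (simp add: fraction_add a_comm m_comm)
    have bd: "b \<otimes> d \<in> carrier R - {\<zero>}" and df: "d \<otimes> f \<in> carrier R - {\<zero>}"
      using nonzero_mult[OF x(3) y(3)] nonzero_mult[OF y(3) z(3)] by auto
    show "(x \<oplus>\<^bsub>?F\<^esub> y) \<oplus>\<^bsub>?F\<^esub> z = x \<oplus>\<^bsub>?F\<^esub> (y \<oplus>\<^bsub>?F\<^esub> z)"
    proof -
      have "(x \<oplus>\<^bsub>?F\<^esub> y) \<oplus>\<^bsub>?F\<^esub> z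
          = fraction R ((a \<otimes> d \<oplus> c \<otimes> b) \<otimes> f \<oplus> e \<otimes> (b \<otimes> d)) ((b \<otimes> d) \<otimes> f)"
        using x y z bd by (simp add: fraction_add)
      also have "(a \<otimes> d \<oplus> c \<otimes> b) \<otimes> f \<oplus> e \<otimes> (b \<otimes> d) = a \<otimes> (d \<otimes> f) \<oplus> (c \<otimes> f \<oplus> e \<otimes> d) \<otimes> b"
        using x y z by (simp add: m_ac l_distr r_distr a_ac)
      also have "(b \<otimes> d) \<otimes> f = b \<otimes> (d \<otimes> f)" using x y z by (simp add: m_ac)
      also have "fraction R (a \<otimes> (d \<otimes> f) \<oplus> (c \<otimes> f \<oplus> e \<otimes> d) \<otimes> b) (b \<otimes> (d \<otimes> f))
          = x \<oplus>\<^bsub>?F\<^esub> (y \<oplus>\<^bsub>?F\<^esub> z)"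
        using x y z df by (simp add: fraction_add)
      finally show ?thesis .
    qed
  next
    show "\<zero>\<^bsub>?F\<^esub> \<in> carrier ?F" by (simp add: fraction_zero fraction_closed)
  next
    fix x assume "x \<in> carrier ?F"
    then obtain a b where x: "x = fraction R a b" "a \<in> carrier R" "b \<in> carrier R - {\<zero>}"
      by (rule fraction_cases)
    show "\<zero>\<^bsub>?F\<^esub> \<oplus>\<^bsub>?F\<^esub> x = x" using x by (simp add: fraction_zero fraction_add)
    have "fraction R (\<ominus> a) b \<oplus>\<^bsub>?F\<^esub> x = fraction R (\<ominus> a \<otimes> b \<oplus> a \<otimes> b) (b \<otimes> b)"
      using x by (simp add: fraction_add)
    also have "\<dots> = \<zero>\<^bsub>?F\<^esub>"
      using x nonzero_mult[of b b] by (simp add: fraction_zero fraction_eq_iff l_minus l_neg)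
    finally show "\<exists>y\<in>carrier ?F. y \<oplus>\<^bsub>?F\<^esub> x = \<zero>\<^bsub>?F\<^esub>"
      using x fraction_closed[of "\<ominus> a" b] by auto
  qed
  have cm: "comm_monoid ?F"
  proof (rule comm_monoidI)
    fix x y z assume xyz: "x \<in> carrier ?F" "y \<in> carrier ?F" "z \<in> carrier ?F"
    from xyz(1) obtain a b where x: "x = fraction R a b" "a \<in> carrier R" "b \<in> carrier R - {\<zero>}"
      by (rule fraction_cases)
    from xyz(2) obtain c d where y: "y = fraction R c d" "c \<in> carrier R" "d \<in> carrier R - {\<zero>}"
      by (rule fraction_cases)
    from xyz(3) obtain e f where z: "z = fraction R e f" "e \<in> carrier R" "f \<in> carrier R - {\<zero>}"
      by (rule fraction_cases)
    have bd: "b \<otimes> d \<in> carrier R - {\<zero>}" and df: "d \<otimes> f \<in> carrier R - {\<zero>}"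
      using nonzero_mult[OF x(3) y(3)] nonzero_mult[OF y(3) z(3)] by auto
    show "x \<otimes>\<^bsub>?F\<^esub> y \<in> carrier ?F" using x y bd by (simp add: fraction_mult fraction_closed)
    show "x \<otimes>\<^bsub>?F\<^esub> y = y \<otimes>\<^bsub>?F\<^esub> x" using x y by (simp add: fraction_mult m_comm)
    show "(x \<otimes>\<^bsub>?F\<^esub> y) \<otimes>\<^bsub>?F\<^esub> z = x \<otimes>\<^bsub>?F\<^esub> (y \<otimes>\<^bsub>?F\<^esub> z)"
      using x y z bd df by (simp add: fraction_mult m_assoc)
  next
    show "\<one>\<^bsub>?F\<^esub> \<in> carrier ?F" by (simp add: fraction_one fraction_closed)
  next
    fix x assume "x \<in> carrier ?F"
    then obtain a b where x: "x = fraction R a b" "a \<in> carrier R" "b \<in> carrier R - {\<zero>}"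
      by (rule fraction_cases)
    then show "\<one>\<^bsub>?F\<^esub> \<otimes>\<^bsub>?F\<^esub> x = x" by (simp add: fraction_one fraction_mult)
  qed
  have cr: "cring ?F"
  proof (rule cringI[OF ag cm])
    fix x y z assume xyz: "x \<in> carrier ?F" "y \<in> carrier ?F" "z \<in> carrier ?F"
    from xyz(1) obtain a b where x: "x = fraction R a b" "a \<in> carrier R" "b \<in> carrier R - {\<zero>}"
      by (rule fraction_cases)
    from xyz(2) obtain c d where y: "y = fraction R c d" "c \<in> carrier R" "d \<in> carrier R - {\<zero>}"
      by (rule fraction_cases)
    from xyz(3) obtain e f where z: "z = fraction R e f" "e \<in> carrier R" "f \<in> carrier R - {\<zero>}"
      by (rule fraction_cases)
    note n1 = nonzero_mult[OF x(3) y(3)] nonzero_mult[OF x(3) z(3)] nonzero_mult[OF y(3) z(3)]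
    note n = n1 nonzero_mult[OF n1(1) z(3)] nonzero_mult[OF n1(2) n1(3)]
    have "(x \<oplus>\<^bsub>?F\<^esub> y) \<otimes>\<^bsub>?F\<^esub> z = fraction R ((a \<otimes> d \<oplus> c \<otimes> b) \<otimes> e) (b \<otimes> d \<otimes> f)"
      using x y z n by (simp add: fraction_add fraction_mult)
    also have "\<dots> = fraction R (a \<otimes> e \<otimes> (d \<otimes> f) \<oplus> c \<otimes> e \<otimes> (b \<otimes> f)) (b \<otimes> f \<otimes> (d \<otimes> f))"
      using x y z n by (subst fraction_eq_iff) (auto simp: m_ac l_distr r_distr)
    also have "\<dots> = x \<otimes>\<^bsub>?F\<^esub> z \<oplus>\<^bsub>?F\<^esub> y \<otimes>\<^bsub>?F\<^esub> z"
      using x y z n by (simp add: fraction_add fraction_mult)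
    finally show "(x \<oplus>\<^bsub>?F\<^esub> y) \<otimes>\<^bsub>?F\<^esub> z = x \<otimes>\<^bsub>?F\<^esub> z \<oplus>\<^bsub>?F\<^esub> y \<otimes>\<^bsub>?F\<^esub> z" .
  qed
  interpret F: cring ?F by (rule cr)
  show ?thesis
  proof (rule F.cring_fieldI2)
    show "\<zero>\<^bsub>?F\<^esub> \<noteq> \<one>\<^bsub>?F\<^esub>" by (simp add: fraction_one fraction_zero fraction_eq_iff)
  next
    fix x assume "x \<in> carrier ?F" and nz: "x \<noteq> \<zero>\<^bsub>?F\<^esub>"
    then obtain a b where x: "x = fraction R a b" "a \<in> carrier R" "b \<in> carrier R - {\<zero>}"
      using fraction_cases by blast
    have a: "a \<in> carrier R - {\<zero>}" using nz x by (auto simp: fraction_zero fraction_eq_iff)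
    have "x \<otimes>\<^bsub>?F\<^esub> fraction R b a = fraction R (a \<otimes> b) (b \<otimes> a)" using x a by (simp add: fraction_mult)
    also have "\<dots> = \<one>\<^bsub>?F\<^esub>" using x a nonzero_mult[of b a] by (simp add: fraction_one fraction_eq_iff m_comm)
    finally show "\<exists>y\<in>carrier ?F. x \<otimes>\<^bsub>?F\<^esub> y = \<one>\<^bsub>?F\<^esub>" using x a fraction_closed[of b a] by auto
  qed
qed

end

section \<open>Graphs\<close>

text \<open>An undirected graph is a symmetric digraph, as in the locale \<^locale>\<open>graph\<close>.
  For such a graph the connected components are the members of \<^const>\<open>pre_digraph.sccs\<close>.\<close>

definition unitary_cayley_graph :: "('a, 'b) ring_scheme \<Rightarrow> ('a, 'a \<times> 'a) pre_digraph" where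
  "unitary_cayley_graph S = with_proj
     \<lparr>pverts = carrier S,
      parcs = {(x, y). x \<in> carrier S \<and> y \<in> carrier S \<and> x \<ominus>\<^bsub>S\<^esub> y \<in> Units S}\<rparr>"

definition bipartite :: "('a, 'b) pre_digraph \<Rightarrow> bool" where
  "bipartite G \<longleftrightarrow> (\<exists>U V. verts G = U \<union> V \<and> U \<inter> V = {} \<and>
     (\<forall>e \<in> arcs G. tail G e \<in> U \<and> head G e \<in> V \<or> tail G e \<in> V \<and> head G e \<in> U))"

text \<open>With all arc weights equal to \<open>1\<close>, \<^const>\<open>wf_digraph.\<mu>\<close> is the usual graph distance.\<close>

definition diameter :: "('a, 'b) pre_digraph \<Rightarrow> ereal" where
  "diameter G = (SUP u \<in> verts G. SUP v \<in> verts G. wf_digraph.\<mu> G (\<lambda>_. 1) u v)"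

lemma graph_unitary_cayley_graph:
  assumes "cring S" "finite (carrier S)" "carrier S \<noteq> {\<zero>\<^bsub>S\<^esub>}"
  shows "graph (unitary_cayley_graph S)"
proof -
  interpret cring S by fact
  have ne: "\<one>\<^bsub>S\<^esub> \<noteq> \<zero>\<^bsub>S\<^esub>" using assms(3) one_zeroD by blast
  let ?A = "{(x, y). x \<in> carrier S \<and> y \<in> carrier S \<and> x \<ominus>\<^bsub>S\<^esub> y \<in> Units S}"
  have fin: "finite ?A" by (rule finite_subset[of _ "carrier S \<times> carrier S"]) (auto simp: assms(2))
  have flip: "y \<ominus>\<^bsub>S\<^esub> x \<in> Units S"
    if "x \<in> carrier S" "y \<in> carrier S" "x \<ominus>\<^bsub>S\<^esub> y \<in> Units S" for x y
  proof -
    have "y \<ominus>\<^bsub>S\<^esub> x = (\<ominus>\<^bsub>S\<^esub> \<one>\<^bsub>S\<^esub>) \<otimes>\<^bsub>S\<^esub> (x \<ominus>\<^bsub>S\<^esub> y)"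
      using that by (simp add: a_minus_def r_distr l_minus minus_minus a_comm minus_add)
    then show ?thesis using that Units_minus_one_closed by auto
  qed
  have irrefl: "x \<ominus>\<^bsub>S\<^esub> x \<notin> Units S" if "x \<in> carrier S" for x
    using that ne by (auto simp: Units_def a_minus_def r_neg)
  have "sym ?A" by (rule symI) (use flip in blast)
  then have "pair_graph \<lparr>pverts = carrier S, parcs = ?A\<rparr>"
    using assms(2) fin irrefl by unfold_locales (auto simp: symmetric_def)
  then interpret pair_graph "\<lparr>pverts = carrier S, parcs = ?A\<rparr>" .
  show ?thesis unfolding unitary_cayley_graph_def by (rule graph_axioms)
qed

end

theory Submission
  imports Defs
begin

text \<open>
  In the finite ring \<open>S = R/I\<close> a unit lies outside every ideal \<open>M\<close> of index two, so an edge of the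
  unitary Cayley graph exchanges the two residue classes of all these \<open>M\<close> simultaneously. Conversely,
  if \<open>z\<close> lies in every ideal of index two, then by the Chinese remainder theorem there is a \<open>u\<close> that is
  congruent to neither \<open>0\<close> nor \<open>z\<close> modulo any maximal ideal, so that \<open>z = u + (z - u)\<close> is a sum of two
  units. Hence two vertices are joined by a walk of length two if they agree modulo all ideals of
  index two, by a walk of length three if they agree modulo none of them, and lie in different
  components otherwise. So the components correspond to the subsets of the set of the \<open>m\<close> ideals of
  index two, up to complement; each \<open>M\<close> yields a bipartition, and translations permute the components.
  Finally, the ideals of index two in \<open>S\<close> come from the primes \<open>P \<supseteq> I\<close> of \<open>R\<close> with \<open>|R/P| = 2\<close>, and in
  a Dedekind domain such a \<open>P\<close> divides \<open>I\<close>.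
\<close>

section \<open>Ideals of index two\<close>

text \<open>Maximality forces the ideal generated by \<open>M\<close> and \<open>N\<close>, which is
  \<open>M + N\<close>, to be the whole ring.\<close>

lemma (in cring) maximalideal_comaximal:
  assumes "maximalideal M R" "ideal N R" "\<not> N \<subseteq> M"
  obtains m n where "m \<in> M" "n \<in> N" "\<one> = m \<oplus> n"
proof -
  interpret M: maximalideal M R by fact
  interpret N: ideal N R by fact
  have sub: "M \<union> N \<subseteq> Idl (M \<union> N)" by (rule genideal_self) (use M.a_subset N.a_subset in blast)
  interpret J: ideal "Idl (M \<union> N)" R
    by (rule genideal_ideal) (use M.a_subset N.a_subset in blast)
  have "Idl (M \<union> N) = carrier R"
    using M.I_maximal[OF J.is_ideal _ J.a_subset] sub assms(3) by blast
  then have "\<one> \<in> M <+>\<^bsub>R\<^esub> N"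
    using union_genideal[OF M.is_ideal N.is_ideal] by simp
  then show thesis using that by (auto simp: set_add_def')
qed

context cring
begin

text \<open>If there are two classes, they can only be \<open>M\<close> and \<open>M + 1\<close>.
  The right-hand side speaks of elements and not of cosets, so it can be carried to a quotient ring
  by translating membership.\<close>

lemma card_quot_eq_two_iff:
  assumes "ideal M R"
  shows "card (carrier (R Quot M)) = 2 \<longleftrightarrow> \<one> \<notin> M \<and> (\<forall>x\<in>carrier R. x \<in> M \<or> x \<ominus> \<one> \<in> M)"
proof -
  interpret M: ideal M R by fact
  have carr: "carrier (R Quot M) = (\<lambda>x. M +> x) ` carrier R"
    by (auto simp: FactRing_def A_RCOSETS_def')
  have eq: "M +> x = M +> y \<longleftrightarrow> x \<ominus> y \<in> M" if "x \<in> carrier R" "y \<in> carrier R" for x y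
    using quotient_eq_iff_same_a_r_cos[OF assms that] by simp
  have M0: "M +> \<zero> = M" using a_rcos_zero[OF assms M.zero_closed] .
  have eq0: "M +> x = M \<longleftrightarrow> x \<in> M" if "x \<in> carrier R" for x
    using eq[OF that zero_closed] that M0 by (simp add: a_minus_def)
  show ?thesis
  proof
    assume "card (carrier (R Quot M)) = 2"
    then obtain A B where AB: "(\<lambda>x. M +> x) ` carrier R = {A, B}" "A \<noteq> B"
      unfolding carr card_2_iff by blast
    then obtain z where z: "z \<in> carrier R" "M +> z \<noteq> M" by (metis imageE insertCI)
    have in_AB: "M +> x = A \<or> M +> x = B" if "x \<in> carrier R" for x
      using AB that by blast
    have one: "\<one> \<notin> M"
      using z M.one_imp_carrier eq0 by blast
    moreover have "x \<in> M \<or> x \<ominus> \<one> \<in> M" if "x \<in> carrier R" for x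
      using in_AB[OF that] in_AB[OF one_closed] in_AB[OF zero_closed] M0 eq0[OF that] eq0[OF one_closed]
        eq[OF that one_closed] one by metis
    ultimately show "\<one> \<notin> M \<and> (\<forall>x\<in>carrier R. x \<in> M \<or> x \<ominus> \<one> \<in> M)" by blast
  next
    assume *: "\<one> \<notin> M \<and> (\<forall>x\<in>carrier R. x \<in> M \<or> x \<ominus> \<one> \<in> M)"
    have "(\<lambda>x. M +> x) ` carrier R = {M, M +> \<one>}"
    proof (intro equalityI subsetI)
      fix A assume "A \<in> (\<lambda>x. M +> x) ` carrier R"
      then show "A \<in> {M, M +> \<one>}" using * eq0 eq[OF _ one_closed] by auto
    next
      fix A assume "A \<in> {M, M +> \<one>}"
      then show "A \<in> (\<lambda>x. M +> x) ` carrier R" using M0 by auto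
    qed
    then show "card (carrier (R Quot M)) = 2"
      using * eq0[OF one_closed] by (auto simp: carr card_2_iff)
  qed
qed

definition index_two_ideals :: "'a set set" where
  "index_two_ideals = {M. ideal M R \<and> card (carrier (R Quot M)) = 2}"

lemma index_two_idealD:
  assumes "M \<in> index_two_ideals"
  shows "ideal M R" "\<one> \<notin> M" "\<And>x. x \<in> carrier R \<Longrightarrow> x \<in> M \<or> x \<ominus> \<one> \<in> M"
  using assms card_quot_eq_two_iff unfolding index_two_ideals_def by blast+

text \<open>In a quotient with two elements all nonzero classes coincide, so a difference vanishes
  exactly when both arguments vanish or neither does.\<close>

lemma index_two_minus_mem_iff:
  assumes "M \<in> index_two_ideals" "x \<in> carrier R" "y \<in> carrier R"
  shows "x \<ominus> y \<in> M \<longleftrightarrow> (x \<in> M \<longleftrightarrow> y \<in> M)"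
proof -
  interpret M: ideal M R by (rule index_two_idealD(1)[OF assms(1)])
  have minus: "u \<ominus> v \<in> M" if "u \<in> M" "v \<in> M" for u v
    using that by (simp add: a_minus_def)
  show ?thesis
  proof (cases "y \<in> M")
    case True
    have "x = (x \<ominus> y) \<oplus> y" using assms by (simp add: a_minus_def a_assoc l_neg)
    then have "x \<ominus> y \<in> M \<Longrightarrow> x \<in> M" using True by (metis M.a_closed)
    then show ?thesis using True minus by blast
  next
    case y: False
    have "y = x \<ominus> (x \<ominus> y)" using assms(2,3) by algebra
    then have "x \<in> M \<Longrightarrow> x \<ominus> y \<notin> M" using y minus by metis
    moreover have "x \<ominus> y = (x \<ominus> \<one>) \<ominus> (y \<ominus> \<one>)"
      using assms(2,3) one_closed by algebra
    then have "x \<notin> M \<Longrightarrow> x \<ominus> y \<in> M"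
      using y minus index_two_idealD(3)[OF assms(1)] assms(2,3) by metis
    ultimately show ?thesis using y by blast
  qed
qed

text \<open>An ideal above \<open>M\<close> with an element \<open>x\<close> outside
  \<open>M\<close> also contains \<open>x - 1\<close>, hence \<open>1\<close>.\<close>

lemma index_two_maximal:
  assumes "M \<in> index_two_ideals"
  shows "maximalideal M R"
proof (rule maximalidealI)
  show "ideal M R" by (rule index_two_idealD(1)[OF assms])
  show "carrier R \<noteq> M" using index_two_idealD(2)[OF assms] by auto
  fix J assume J: "ideal J R" "M \<subseteq> J"
  interpret J: ideal J R by fact
  show "J = M \<or> J = carrier R"
  proof (rule disjCI)
    assume "J \<noteq> carrier R"
    then have "\<one> \<notin> J" using J.one_imp_carrier by blast
    have "x \<in> M" if x: "x \<in> J" for x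
    proof (rule ccontr)
      assume "x \<notin> M"
      then have "x \<ominus> \<one> \<in> J" using index_two_idealD(3)[OF assms] x J(2) J.Icarr by blast
      then have "x \<ominus> (x \<ominus> \<one>) \<in> J" using x by (simp add: a_minus_def)
      moreover have "x \<ominus> (x \<ominus> \<one>) = \<one>"
        using J.Icarr[OF x] by (simp add: a_minus_def minus_add r_neg a_assoc[symmetric])
      ultimately show False using \<open>\<one> \<notin> J\<close> by simp
    qed
    then show "J = M" using J(2) by blast
  qed
qed

section \<open>Units, maximal ideals and the Chinese remainder theorem\<close>

lemma Units_not_in_maximalideal:
  assumes "maximalideal M R" "u \<in> Units R"
  shows "u \<notin> M"
proof
  interpret M: maximalideal M R by fact
  assume "u \<in> M"
  then have "inv u \<otimes> u \<in> M" using assms(2) by (intro M.I_l_closed) auto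
  then show False using assms(2) M.one_imp_carrier M.I_notcarr by simp
qed

text \<open>There are only finitely many ideals, so a maximal one among the proper ideals containing
  \<open>x\<close> exists without Zorn's lemma; the principal ideal of \<open>x\<close> is one of
  them.\<close>

lemma nonunit_in_maximalideal:
  assumes "finite (carrier R)" "x \<in> carrier R" "x \<notin> Units R"
  obtains M where "maximalideal M R" "x \<in> M"
proof -
  define F where "F = {J. ideal J R \<and> J \<noteq> carrier R \<and> x \<in> J}"
  have "F \<subseteq> Pow (carrier R)"
    using additive_subgroup.a_subset ideal.axioms(1) unfolding F_def by blast
  then have "finite F" using assms(1) by (meson finite_Pow_iff finite_subset)
  moreover have "PIdl x \<in> F"
  proof -
    have "\<one> \<notin> PIdl x" using assms(2,3) by (auto simp: cgenideal_def Units_def m_comm)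
    then show ?thesis using cgenideal_ideal cgenideal_self assms(2) by (auto simp: F_def)
  qed
  ultimately obtain M where M: "M \<in> F" "\<And>J. J \<in> F \<Longrightarrow> M \<subseteq> J \<Longrightarrow> J = M"
    using finite_has_maximal[of F] by blast
  have "maximalideal M R"
    using M by (intro maximalidealI) (auto simp: F_def)
  then show thesis using that M(1) by (auto simp: F_def)
qed

text \<open>Each \<open>M\<close> in \<open>F\<close> is comaximal with \<open>N\<close> and so has
  an element that is \<open>1\<close> modulo \<open>N\<close>; \<open>e\<close> is the product of
  these elements.\<close>

lemma maximalideals_separating_element:
  assumes "finite F" "\<And>M. M \<in> F \<Longrightarrow> maximalideal M R" "maximalideal N R" "N \<notin> F"
  shows "\<exists>e\<in>carrier R. (\<forall>M\<in>F. e \<in> M) \<and> e \<ominus> \<one> \<in> N"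
  using assms(1,2,4)
proof (induction F rule: finite_induct)
  case empty
  interpret N: maximalideal N R by fact
  show ?case using N.zero_closed by (intro bexI[of _ \<one>]) (auto simp: a_minus_def r_neg)
next
  case (insert L F)
  interpret N: maximalideal N R by fact
  interpret L: maximalideal L R using insert by simp
  obtain e where e: "e \<in> carrier R" "\<forall>M\<in>F. e \<in> M" "e \<ominus> \<one> \<in> N" using insert by auto
  have "\<not> N \<subseteq> L"
    using N.I_maximal[OF L.is_ideal _ L.a_subset] L.I_notcarr insert.prems(2) by blast
  then obtain l n where l: "l \<in> L" and n: "n \<in> N" and one: "\<one> = l \<oplus> n"
    using maximalideal_comaximal[OF L.is_maximalideal N.is_ideal] by blast
  have lR: "l \<in> carrier R" and nR: "n \<in> carrier R" using l n L.Icarr N.Icarr by auto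
  have "l \<otimes> e \<ominus> \<one> = l \<otimes> (e \<ominus> \<one>) \<oplus> \<ominus> n"
  proof -
    have "l \<otimes> (e \<ominus> \<one>) \<oplus> \<ominus> n = l \<otimes> e \<ominus> (l \<oplus> n)"
      using lR nR e(1) by (simp add: a_minus_def r_distr r_minus minus_add a_assoc)
    then show ?thesis by (simp add: one)
  qed
  then have "l \<otimes> e \<ominus> \<one> \<in> N" using n lR e(3) N.I_l_closed by simp
  moreover have "l \<otimes> e \<in> M" if "M \<in> insert L F" for M
    using that l e(1,2) lR ideal.I_l_closed[of M R e l] insert.prems(1)[THEN maximalideal.axioms(1)] L.I_r_closed
    by blast
  ultimately show ?case using lR e(1) by (intro bexI[of _ "l \<otimes> e"]) auto
qed

text \<open>A solution for \<open>F\<close> is corrected at a new ideal \<open>N\<close> by a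
  multiple of an element that is \<open>0\<close> modulo every member of \<open>F\<close> and
  \<open>1\<close> modulo \<open>N\<close>.\<close>

lemma chinese_remainder_maximalideals:
  assumes "finite F" "\<And>M. M \<in> F \<Longrightarrow> maximalideal M R" "\<And>M. M \<in> F \<Longrightarrow> t M \<in> carrier R"
  shows "\<exists>u\<in>carrier R. \<forall>M\<in>F. u \<ominus> t M \<in> M"
  using assms
proof (induction F rule: finite_induct)
  case empty
  then show ?case by blast
next
  case (insert N F)
  interpret N: maximalideal N R using insert by simp
  obtain u where u: "u \<in> carrier R" "\<forall>M\<in>F. u \<ominus> t M \<in> M" using insert by auto
  obtain e where e: "e \<in> carrier R" "\<forall>M\<in>F. e \<in> M" "e \<ominus> \<one> \<in> N"
    using maximalideals_separating_element[OF insert.hyps(1) _ N.is_maximalideal insert.hyps(2)] insert.prems(1)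
    by blast
  define d where "d = t N \<ominus> u"
  have tN: "t N \<in> carrier R" and d: "d \<in> carrier R" using insert.prems(2) u by (simp_all add: d_def)
  have "(u \<oplus> d \<otimes> e) \<ominus> t N = d \<otimes> (e \<ominus> \<one>)"
    using u(1) tN e(1) d by (simp add: d_def a_minus_def r_distr l_distr r_minus l_minus minus_add a_ac)
  then have "(u \<oplus> d \<otimes> e) \<ominus> t N \<in> N" using N.I_l_closed[OF e(3) d] by simp
  moreover have "(u \<oplus> d \<otimes> e) \<ominus> t M \<in> M" if "M \<in> F" for M
  proof -
    interpret M: maximalideal M R using insert that by simp
    have "(u \<oplus> d \<otimes> e) \<ominus> t M = (u \<ominus> t M) \<oplus> d \<otimes> e"
      using u(1) e(1) d insert.prems(2)[of M] that by (simp add: a_minus_def a_ac)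
    then show ?thesis using u(2) e(2) that d M.I_l_closed by simp
  qed
  ultimately show ?case using u(1) d e(1) by (intro bexI[of _ "u \<oplus> d \<otimes> e"]) auto
qed

text \<open>At a maximal ideal \<open>M\<close> of index at least three some residue class avoids both \<open>0\<close> and
  \<open>z\<close>; at one of index two the class of \<open>1\<close> does, because \<open>z \<in> M\<close>.\<close>

lemma minus_unit_is_unit:
  assumes fin: "finite (carrier R)" and z: "z \<in> carrier R" "\<And>M. M \<in> index_two_ideals \<Longrightarrow> z \<in> M"
  shows "\<exists>u\<in>Units R. z \<ominus> u \<in> Units R"
proof -
  define F where "F = {M. maximalideal M R}"
  have "F \<subseteq> Pow (carrier R)"
    using additive_subgroup.a_subset ideal.axioms(1) maximalideal.axioms(1) unfolding F_def by blast
  then have "finite F" using fin by (meson finite_Pow_iff finite_subset)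
  have ex: "\<exists>t\<in>carrier R. t \<notin> M \<and> z \<ominus> t \<notin> M" if "M \<in> F" for M
  proof -
    interpret M: maximalideal M R using that by (simp add: F_def)
    have one: "\<one> \<notin> M" using M.one_imp_carrier M.I_notcarr by blast
    show ?thesis
    proof (cases "z \<in> M")
      case True
      have "z \<ominus> (z \<ominus> \<one>) = \<one>" using z(1) by (simp add: a_minus_def minus_add r_neg a_assoc[symmetric])
      then have "z \<ominus> \<one> \<notin> M" using True one by (metis M.a_closed M.a_inv_closed a_minus_def)
      then show ?thesis using one by blast
    next
      case False
      show ?thesis
      proof (rule ccontr)
        \<comment> \<open>If no \<open>t\<close> works, then \<open>z - x\<close> is in
          \<open>M\<close> for every \<open>x\<close> outside \<open>M\<close>, also for
          \<open>x = 1\<close>. Subtracting gives \<open>x - 1\<close> in \<open>M\<close>, so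
          \<open>M\<close> has index two and must contain \<open>z\<close>.\<close>
        assume no: "\<not> ?thesis"
        have all: "x \<in> M \<or> x \<ominus> \<one> \<in> M" if x: "x \<in> carrier R" for x
        proof (cases "x \<in> M")
          case False
          have "z \<ominus> x \<in> M" "z \<ominus> \<one> \<in> M" using no False x one by blast+
          then have "(z \<ominus> \<one>) \<oplus> \<ominus> (z \<ominus> x) \<in> M" by blast
          moreover have "(z \<ominus> \<one>) \<oplus> \<ominus> (z \<ominus> x) = x \<ominus> \<one>"
            using x z(1) by (simp add: a_minus_def minus_add a_ac r_neg1 r_neg2)
          ultimately show ?thesis by simp
        qed simp
        then have "M \<in> index_two_ideals"
          using one card_quot_eq_two_iff[OF M.is_ideal] M.is_ideal by (simp add: index_two_ideals_def)
        then show False using z(2) False by blast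
      qed
    qed
  qed
  then obtain t where t: "\<And>M. M \<in> F \<Longrightarrow> t M \<in> carrier R \<and> t M \<notin> M \<and> z \<ominus> t M \<notin> M" by metis
  obtain u where u: "u \<in> carrier R" "\<forall>M\<in>F. u \<ominus> t M \<in> M"
    using chinese_remainder_maximalideals[OF \<open>finite F\<close>, of t] t by (auto simp: F_def)
  have avoid: "u \<notin> M \<and> z \<ominus> u \<notin> M" if "M \<in> F" for M
  proof -
    interpret M: maximalideal M R using that by (simp add: F_def)
    have tM: "t M \<in> carrier R" "t M \<notin> M" "z \<ominus> t M \<notin> M" and d: "u \<ominus> t M \<in> M" using t u that by auto
    have "t M = u \<oplus> \<ominus> (u \<ominus> t M)" "z \<ominus> t M = (z \<ominus> u) \<oplus> (u \<ominus> t M)"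
      using u(1) z(1) tM(1) by algebra+
    then show ?thesis using tM d by (metis M.a_closed M.a_inv_closed)
  qed
  have "x \<in> Units R" if "x \<in> carrier R" "\<And>M. M \<in> F \<Longrightarrow> x \<notin> M" for x
    using nonunit_in_maximalideal[OF fin that(1)] that(2) by (auto simp: F_def)
  then show ?thesis using avoid u(1) z(1) by blast
qed

end

section \<open>Components of the unitary Cayley graph\<close>

text \<open>Nontriviality keeps the graph free of loops: in the zero ring \<open>0\<close> is a
  unit.\<close>

locale finite_cring = cring +
  assumes finite_carrier: "finite (carrier R)" and nontrivial: "carrier R \<noteq> {\<zero>}"
begin

abbreviation G :: "('a, 'a \<times> 'a) pre_digraph" where
  "G \<equiv> unitary_cayley_graph R"

sublocale G: graph G
  by (rule graph_unitary_cayley_graph[OF is_cring finite_carrier nontrivial])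

lemma G_simps:
  "verts G = carrier R"
  "arcs G = {(x, y). x \<in> carrier R \<and> y \<in> carrier R \<and> x \<ominus> y \<in> Units R}"
  "tail G = fst" "head G = snd"
  by (simp_all add: unitary_cayley_graph_def)

text \<open>The image of \<open>x\<close> in the product of the two-element quotients, coded as the
  set of coordinates at which it vanishes.\<close>

definition side :: "'a \<Rightarrow> 'a set set" where
  "side x = {M \<in> index_two_ideals. x \<in> M}"

text \<open>This will be the component of \<open>x\<close>: an edge complements \<open>side\<close>,
  so a walk preserves \<open>side\<close> up to complement.\<close>

definition linked :: "'a \<Rightarrow> 'a set" where
  "linked x = {y \<in> carrier R. side y = side x \<or> side y = index_two_ideals - side x}"

lemma side_subset: "side x \<subseteq> index_two_ideals"
  by (auto simp: side_def)

lemma linked_eq: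
  assumes "x \<in> carrier R"
  shows "linked x = {y \<in> carrier R. (\<forall>M\<in>index_two_ideals. y \<ominus> x \<in> M) \<or> (\<forall>M\<in>index_two_ideals. y \<ominus> x \<notin> M)}"
  using assms index_two_minus_mem_iff unfolding linked_def side_def by blast

lemma finite_index_two_ideals: "finite index_two_ideals"
proof -
  have "index_two_ideals \<subseteq> Pow (carrier R)"
    using additive_subgroup.a_subset ideal.axioms(1) index_two_idealD(1) by blast
  then show ?thesis using finite_carrier by (meson finite_Pow_iff finite_subset)
qed

text \<open>Chinese remaindering with residue \<open>0\<close> at the members of \<open>B\<close>
  and \<open>1\<close> at the other ideals.\<close>

lemma side_surj:
  assumes "B \<subseteq> index_two_ideals"
  obtains x where "x \<in> carrier R" "side x = B"
proof -
  have "\<exists>x\<in>carrier R. \<forall>M\<in>index_two_ideals. x \<ominus> (if M \<in> B then \<zero> else \<one>) \<in> M"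
    by (rule chinese_remainder_maximalideals) (auto simp: finite_index_two_ideals index_two_maximal)
  then obtain x where x: "x \<in> carrier R" "\<And>M. M \<in> index_two_ideals \<Longrightarrow> x \<ominus> (if M \<in> B then \<zero> else \<one>) \<in> M"
    by blast
  have "x \<in> M \<longleftrightarrow> M \<in> B" if M: "M \<in> index_two_ideals" for M
  proof -
    have "\<zero> \<in> M" "\<one> \<notin> M"
      using index_two_idealD(1,2)[OF M] additive_subgroup.zero_closed ideal.axioms(1) by blast+
    then show ?thesis
      using x(2)[OF M] index_two_minus_mem_iff[OF M x(1), of "if M \<in> B then \<zero> else \<one>"] by auto
  qed
  then have "side x = B" using assms by (auto simp: side_def)
  then show thesis using that x(1) by blast
qed

text \<open>The unit \<open>x - y\<close> lies outside every maximal ideal, so \<open>x\<close> and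
  \<open>y\<close> differ in every two-element quotient.\<close>

lemma side_adjacent:
  assumes "(x, y) \<in> arcs G"
  shows "side y = index_two_ideals - side x"
proof -
  have xy: "x \<in> carrier R" "y \<in> carrier R" "x \<ominus> y \<in> Units R" using assms by (auto simp: G_simps)
  have "x \<in> M \<longleftrightarrow> y \<notin> M" if "M \<in> index_two_ideals" for M
    using index_two_minus_mem_iff[OF that xy(1,2)] Units_not_in_maximalideal[OF index_two_maximal[OF that] xy(3)]
    by blast
  then show ?thesis by (auto simp: side_def)
qed

lemma adjacent_linked:
  assumes "(x, y) \<in> arcs G" "x \<in> linked z"
  shows "y \<in> linked z"
  using side_adjacent[OF assms(1)] assms side_subset by (auto simp: linked_def G_simps)

text \<open>Equal sides put \<open>x - y\<close> into every ideal of index two, so it is the sum of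
  a unit \<open>u\<close> and another unit; the midpoint is \<open>y + u\<close>.\<close>

lemma two_step:
  assumes "x \<in> carrier R" "y \<in> carrier R" "side x = side y"
  obtains w where "(x, w) \<in> arcs G" "(w, y) \<in> arcs G"
proof -
  have "x \<ominus> y \<in> M" if "M \<in> index_two_ideals" for M
    using assms index_two_minus_mem_iff[OF that assms(1,2)] that by (auto simp: side_def)
  then obtain u where u: "u \<in> Units R" "(x \<ominus> y) \<ominus> u \<in> Units R"
    using minus_unit_is_unit[OF finite_carrier] assms(1,2) by (metis minus_closed)
  have uR: "u \<in> carrier R" using u by blast
  have "x \<ominus> (y \<oplus> u) = (x \<ominus> y) \<ominus> u" "(y \<oplus> u) \<ominus> y = u"
    using assms(1,2) uR by algebra+
  then have "(x, y \<oplus> u) \<in> arcs G" "(y \<oplus> u, y) \<in> arcs G"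
    using u assms(1,2) uR by (simp_all add: G_simps)
  then show thesis by (rule that)
qed

text \<open>Subtracting \<open>1\<close> is a step to the opposite side.\<close>

lemma walk_length_le_3:
  assumes "x \<in> carrier R" "y \<in> linked x"
  obtains p where "G.awalk x p y" "length p \<le> 3"
proof -
  have y: "y \<in> carrier R" using assms by (simp add: linked_def)
  consider "side x = side y" | "side y = index_two_ideals - side x"
    using assms(2) by (auto simp: linked_def)
  then show thesis
  proof cases
    case 1
    then obtain w where "(x, w) \<in> arcs G" "(w, y) \<in> arcs G" using two_step assms(1) y by blast
    then have "G.awalk x [(x, w), (w, y)] y" by (auto simp: G.awalk_simps G_simps)
    then show thesis using that by force
  next
    case 2
    define z where "z = x \<ominus> \<one>"
    have z: "z \<in> carrier R" using assms(1) by (simp add: z_def)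
    have "x \<ominus> z = \<one>" using assms(1) one_closed unfolding z_def by algebra
    then have xz: "(x, z) \<in> arcs G" using assms(1) z by (simp add: G_simps)
    then have "side z = side y" using side_adjacent 2 by simp
    then obtain w where "(z, w) \<in> arcs G" "(w, y) \<in> arcs G" using two_step z y by blast
    then have "G.awalk x [(x, z), (z, w), (w, y)] y" using xz by (auto simp: G.awalk_simps G_simps)
    then show thesis using that by force
  qed
qed

lemma scc_of_eq_linked:
  assumes x: "x \<in> carrier R"
  shows "G.scc_of x = linked x"
proof
  have "v \<in> linked x" if "x \<rightarrow>\<^sup>*\<^bsub>G\<^esub> v" for v
    using that
  proof (induction rule: G.reachable_induct)
    case base
    then show ?case using x by (simp add: linked_def)
  next
    case (step v w)
    then have "(v, w) \<in> arcs G" by (auto simp: arcs_ends_def arc_to_ends_def G_simps)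
    then show ?case using adjacent_linked step by blast
  qed
  then show "G.scc_of x \<subseteq> linked x" by (auto simp: G.scc_of_def)
  show "linked x \<subseteq> G.scc_of x"
  proof
    fix y assume "y \<in> linked x"
    then obtain p where "G.awalk x p y" using walk_length_le_3[OF x] by blast
    then show "y \<in> G.scc_of x" using G.reachable_awalk G.scc_ofI_reachable' by metis
  qed
qed

lemma sccs_eq: "G.sccs = (\<lambda>x. G \<restriction> linked x) ` carrier R"
proof -
  have "G.scc_of ` carrier R = linked ` carrier R"
    using scc_of_eq_linked by simp
  then show ?thesis
    unfolding G.sccs_conv_sccs_verts G.sccs_verts_conv_scc_of G_simps by (simp add: image_image)
qed

section \<open>Number, bipartition, diameter and isomorphism of the components\<close>

text \<open>Exactly one of \<open>B\<close> and its complement omits a fixed \<open>N\<close>, so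
  the components are indexed by the subsets of \<open>index_two_ideals - {N}\<close>; this lowers
  the exponent by one.\<close>

lemma card_sccs:
  assumes "index_two_ideals \<noteq> {}"
  shows "card G.sccs = 2 ^ (card index_two_ideals - 1)"
proof -
  obtain N where N: "N \<in> index_two_ideals" using assms by blast
  define comp where "comp B = {y \<in> carrier R. side y = B \<or> side y = index_two_ideals - B}" for B
  have "linked ` carrier R = comp ` Pow (index_two_ideals - {N})"
  proof (intro equalityI subsetI)
    fix V assume "V \<in> linked ` carrier R"
    then obtain x where x: "x \<in> carrier R" "V = linked x" by blast
    show "V \<in> comp ` Pow (index_two_ideals - {N})"
    proof (cases "N \<in> side x")
      case True
      have "V = comp (index_two_ideals - side x)"
        using x side_subset[of x] double_diff[OF side_subset[of x] subset_refl]
        by (auto simp: linked_def comp_def)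
      then show ?thesis using True by blast
    next
      case False
      have "V = comp (side x)" using x by (simp add: linked_def comp_def)
      then show ?thesis using False side_subset[of x] by blast
    qed
  next
    fix V assume "V \<in> comp ` Pow (index_two_ideals - {N})"
    then obtain B where B: "B \<subseteq> index_two_ideals" "V = comp B" by blast
    obtain x where "x \<in> carrier R" "side x = B" using side_surj[OF B(1)] .
    then show "V \<in> linked ` carrier R" using B(2) by (auto simp: linked_def comp_def)
  qed
  moreover have "inj_on comp (Pow (index_two_ideals - {N}))"
  proof (rule inj_onI)
    fix B C assume B: "B \<in> Pow (index_two_ideals - {N})" and C: "C \<in> Pow (index_two_ideals - {N})"
      and eq: "comp B = comp C"
    obtain x where x: "x \<in> carrier R" "side x = B" using side_surj[of B] B by blast
    then have "x \<in> comp C" using eq by (auto simp: comp_def)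
    then show "B = C" using x B C N by (auto simp: comp_def)
  qed
  ultimately have "card (linked ` carrier R) = card (Pow (index_two_ideals - {N}))"
    by (simp add: card_image)
  moreover have "G.sccs_verts = linked ` carrier R"
    unfolding G.sccs_verts_conv_scc_of G_simps using scc_of_eq_linked by simp
  ultimately show ?thesis
    using N finite_index_two_ideals by (simp add: card_Pow flip: G.card_sccs_verts)
qed

text \<open>Membership in one fixed \<open>N\<close> changes along every edge, so it two-colours any
  induced subgraph.\<close>

lemma bipartite_component:
  assumes "index_two_ideals \<noteq> {}"
  shows "bipartite (G \<restriction> V)"
proof -
  obtain N where N: "N \<in> index_two_ideals" using assms by blast
  have "fst e \<in> N \<longleftrightarrow> snd e \<notin> N" if "e \<in> arcs G" for e
    using side_adjacent[of "fst e" "snd e"] that N by (auto simp: side_def)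
  then show ?thesis
    unfolding bipartite_def by (intro exI[of _ "V \<inter> N"] exI[of _ "V - N"]) (auto simp: G_simps)
qed

text \<open>The short walks are found in \<open>G\<close>. They stay in \<open>linked x\<close>,
  which is closed under adjacency, and so bound the distances measured inside the component.\<close>

lemma diameter_component:
  assumes "x \<in> carrier R"
  shows "diameter (G \<restriction> linked x) \<le> 3"
proof -
  let ?H = "G \<restriction> linked x"
  interpret H: wf_digraph ?H by (rule G.wellformed_induce_subgraph)
  have "H.\<mu> (\<lambda>_. 1) u v \<le> 3" if "u \<in> linked x" "v \<in> linked x" for u v
  proof -
    have "u \<in> carrier R" "v \<in> linked u"
      using that double_diff[OF side_subset[of x] subset_refl] by (auto simp: linked_def)
    then obtain p where p: "G.awalk u p v" "length p \<le> 3" by (rule walk_length_le_3)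
    have "H.awalk u p v"
      using p(1) that(1)
    proof (induction p arbitrary: u)
      case Nil
      then show ?case by (auto simp: G.awalk_simps H.awalk_simps)
    next
      case (Cons e p)
      then have e: "e \<in> arcs G" "fst e = u" "G.awalk (snd e) p v" by (auto simp: G.awalk_simps G_simps)
      then have "snd e \<in> linked x" 
        using adjacent_linked[of u "snd e" x] Cons.prems(2) e(1,2) by (metis prod.collapse)
      then show ?case using Cons e by (auto simp: H.awalk_simps G_simps)
    qed
    then have "H.\<mu> (\<lambda>_. 1) u v \<le> ereal (H.awalk_cost (\<lambda>_. 1) p)" by (rule H.min_cost_le_walk_cost)
    also have "H.awalk_cost (\<lambda>_. 1) p = real (length p)" by (induction p) auto
    also have "ereal (real (length p)) \<le> 3"
      using p(2) by simp
    finally show ?thesis .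
  qed
  then show ?thesis unfolding diameter_def by (auto intro!: SUP_least)
qed

lemma translate_linked:
  assumes "x \<in> carrier R" "y \<in> carrier R"
  shows "(\<lambda>v. v \<oplus> (y \<ominus> x)) ` linked x = linked y"
proof -
  have sub: "(\<lambda>v. v \<oplus> (b \<ominus> a)) ` linked a \<subseteq> linked b" if ab: "a \<in> carrier R" "b \<in> carrier R" for a b
  proof -
    have "v \<oplus> (b \<ominus> a) \<ominus> b = v \<ominus> a" if "v \<in> carrier R" for v using that ab by algebra
    then show ?thesis using ab by (auto simp: linked_eq)
  qed
  have "v \<in> (\<lambda>v. v \<oplus> (y \<ominus> x)) ` linked x" if v: "v \<in> linked y" for v
  proof -
    have "v \<in> carrier R" using v by (simp add: linked_def)
    then have "v = v \<oplus> (x \<ominus> y) \<oplus> (y \<ominus> x)" using assms by algebra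
    moreover have "v \<oplus> (x \<ominus> y) \<in> linked x" using sub[OF assms(2,1)] v by blast
    ultimately show ?thesis by blast
  qed
  then show ?thesis using sub[OF assms] by blast
qed

text \<open>Translation by \<open>y - x\<close> leaves differences, hence adjacency, unchanged. Arcs
  are pairs of vertices and are translated in both coordinates.\<close>

lemma components_isomorphic:
  assumes "x \<in> carrier R" "y \<in> carrier R"
  shows "digraph_iso (G \<restriction> linked x) (G \<restriction> linked y)"
proof -
  define t where "t = (\<lambda>v. v \<oplus> (y \<ominus> x))"
  define f where "f = \<lparr>iso_verts = t, iso_arcs = map_prod t t, iso_head = snd, iso_tail = fst\<rparr>"
  have carr: "linked z \<subseteq> carrier R" for z by (auto simp: linked_def)
  have d: "y \<ominus> x \<in> carrier R" using assms by simp
  have inj: "inj_on t (carrier R)" using d by (auto simp: inj_on_def t_def)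
  have verts: "t ` linked x = linked y" unfolding t_def by (rule translate_linked[OF assms])
  have diff: "t u \<ominus> t v = u \<ominus> v" if "u \<in> carrier R" "v \<in> carrier R" for u v
    using that assms unfolding t_def by algebra
  have arcs: "map_prod t t ` arcs (G \<restriction> linked x) = arcs (G \<restriction> linked y)"
  proof (intro equalityI subsetI)
    fix e assume "e \<in> map_prod t t ` arcs (G \<restriction> linked x)"
    then obtain u v where uv: "e = (t u, t v)" "u \<in> linked x" "v \<in> linked x" "u \<ominus> v \<in> Units R"
      by (auto simp: G_simps)
    have "t u \<ominus> t v \<in> Units R" using uv diff[OF subsetD[OF carr uv(2)] subsetD[OF carr uv(3)]] by simp
    moreover have "t u \<in> linked y" "t v \<in> linked y" using verts uv(2,3) by blast+
    ultimately show "e \<in> arcs (G \<restriction> linked y)"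
      using uv(1) subsetD[OF carr] by (simp add: G_simps)
  next
    fix e assume e: "e \<in> arcs (G \<restriction> linked y)"
    then have "fst e \<in> t ` linked x" "snd e \<in> t ` linked x" unfolding verts by (auto simp: G_simps)
    then obtain u v where uv: "u \<in> linked x" "v \<in> linked x" "fst e = t u" "snd e = t v"
      by (elim imageE)
    have uvR: "u \<in> carrier R" "v \<in> carrier R" using uv(1,2) subsetD[OF carr] by blast+
    have "t u \<ominus> t v \<in> Units R" using e by (auto simp: G_simps simp flip: uv(3,4))
    then have "(u, v) \<in> arcs (G \<restriction> linked x)" using uv(1,2) uvR diff[OF uvR] by (simp add: G_simps)
    moreover have "e = map_prod t t (u, v)" using uv(3,4) by (simp add: prod_eq_iff)
    ultimately show "e \<in> map_prod t t ` arcs (G \<restriction> linked x)" by (rule rev_image_eqI)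
  qed
  have "pre_digraph.digraph_isomorphism (G \<restriction> linked x) f"
    unfolding pre_digraph.digraph_isomorphism_def
  proof (intro conjI ballI)
    show "inj_on (iso_verts f) (verts (G \<restriction> linked x))"
      using inj_on_subset[OF inj carr] by (simp add: f_def)
    have "inj_on (map_prod t t) (carrier R \<times> carrier R)" using inj by (intro map_prod_inj_on)
    then have "inj_on (map_prod t t) (arcs (G \<restriction> linked x))"
      by (rule inj_on_subset) (auto simp: G_simps)
    then show "inj_on (iso_arcs f) (arcs (G \<restriction> linked x))" by (simp add: f_def)
  qed (auto simp: f_def G_simps G.wellformed_induce_subgraph)
  moreover have "G \<restriction> linked y = app_iso f (G \<restriction> linked x)"
    using verts arcs by (simp add: app_iso_def f_def induce_subgraph_def G_simps)
  ultimately show ?thesis unfolding digraph_iso_def by blast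
qed

end

section \<open>To contain is to divide\<close>

text \<open>In a noetherian ring the union of a nonempty chain of ideals belongs to the chain, so
  Zorn's lemma applies inside any family.\<close>

lemma (in noetherian_ring) exists_maximal_ideal_of_family:
  assumes "F \<noteq> {}" and "\<And>J. J \<in> F \<Longrightarrow> ideal J R"
  obtains M where "M \<in> F" and "\<And>J. \<lbrakk>J \<in> F; M \<subseteq> J\<rbrakk> \<Longrightarrow> J = M"
proof -
  have "\<exists>M\<in>F. \<forall>J\<in>F. M \<subseteq> J \<longrightarrow> J = M"
  proof (rule subset_Zorn_nonempty[OF assms(1)])
    fix C assume C: "C \<noteq> {}" "subset.chain F C"
    then have "subset.chain {I. ideal I R} C"
      using assms(2) by (auto simp: subset_chain_def)
    then have "\<Union>C \<in> C"
      using ideal_chain_is_trivial C(1) by blast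
    then show "\<Union>C \<in> F"
      using C(2) by (auto simp: subset_chain_def)
  qed
  then show thesis using that by blast
qed

lemma (in noetherian_ring) ascending_ideals_stabilise:
  assumes "\<And>n. ideal (A n) R" and "\<And>n. A n \<subseteq> A (Suc n)"
  obtains n where "A (Suc n) = A n"
proof -
  obtain M where M: "M \<in> range A" "\<And>J. \<lbrakk>J \<in> range A; M \<subseteq> J\<rbrakk> \<Longrightarrow> J = M"
    using exists_maximal_ideal_of_family[of "range A"] assms(1) by blast
  then obtain n where "M = A n" by blast
  then show thesis using M(2)[of "A (Suc n)"] assms(2)[of n] that by blast
qed

text \<open>Serves for \<open>((a) : b)\<close> with \<open>B = {b}\<close> and for
  \<open>(I : P)\<close> with \<open>B = P\<close>.\<close>

lemma (in cring) colon_ideal: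
  assumes "ideal I R" and "B \<subseteq> carrier R"
  shows "ideal {r \<in> carrier R. \<forall>b\<in>B. r \<otimes> b \<in> I} R"
proof -
  interpret I: ideal I R by fact
  have B: "b \<in> carrier R" if "b \<in> B" for b using assms(2) that by blast
  show ?thesis
  proof (rule idealI[OF ring_axioms])
    show "subgroup {r \<in> carrier R. \<forall>b\<in>B. r \<otimes> b \<in> I} (add_monoid R)"
    proof (rule add.subgroupI)
      show "{r \<in> carrier R. \<forall>b\<in>B. r \<otimes> b \<in> I} \<noteq> {}"
        using B I.zero_closed by (auto intro: exI[of _ \<zero>])
    next
      fix r assume "r \<in> {r \<in> carrier R. \<forall>b\<in>B. r \<otimes> b \<in> I}"
      then show "\<ominus> r \<in> {r \<in> carrier R. \<forall>b\<in>B. r \<otimes> b \<in> I}"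
        by (simp add: B l_minus)
    next
      fix r s assume "r \<in> {r \<in> carrier R. \<forall>b\<in>B. r \<otimes> b \<in> I}" "s \<in> {r \<in> carrier R. \<forall>b\<in>B. r \<otimes> b \<in> I}"
      then show "r \<oplus> s \<in> {r \<in> carrier R. \<forall>b\<in>B. r \<otimes> b \<in> I}"
        by (simp add: B l_distr)
    qed simp
  next
    fix r x assume "r \<in> {r \<in> carrier R. \<forall>b\<in>B. r \<otimes> b \<in> I}" "x \<in> carrier R"
    then show "x \<otimes> r \<in> {r \<in> carrier R. \<forall>b\<in>B. r \<otimes> b \<in> I}"
      by (simp add: B m_assoc I.I_l_closed)
    with \<open>x \<in> carrier R\<close> \<open>r \<in> _\<close> show "r \<otimes> x \<in> {r \<in> carrier R. \<forall>b\<in>B. r \<otimes> b \<in> I}"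
      by (simp add: m_comm[of r x])
  qed
qed

section \<open>Powers of a fraction as polynomial expressions\<close>

context domain
begin

abbreviation embed :: "'a \<Rightarrow> ('a \<times> 'a) set" where
  "embed c \<equiv> fraction R c \<one>"

lemma embed_closed: "c \<in> carrier R \<Longrightarrow> embed c \<in> carrier (fraction_field R)"
  by (simp add: fraction_closed)

lemma embed_simps:
  assumes "c \<in> carrier R" "d \<in> carrier R"
  shows "embed (c \<otimes> d) = embed c \<otimes>\<^bsub>fraction_field R\<^esub> embed d"
    and "embed (c \<oplus> d) = embed c \<oplus>\<^bsub>fraction_field R\<^esub> embed d"
    and "embed c = embed d \<longleftrightarrow> c = d"
  using assms by (simp_all add: fraction_closed fraction_mult fraction_add fraction_eq_iff)

text \<open>The ideal generated by \<open>q 0, ..., q n\<close>. The newest generator comes first,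
  to match coefficient lists, whose head is the leading coefficient.\<close>

primrec span_upto :: "(nat \<Rightarrow> 'a) \<Rightarrow> nat \<Rightarrow> 'a set" where
  "span_upto q 0 = PIdl (q 0)"
| "span_upto q (Suc n) = PIdl (q (Suc n)) <+>\<^bsub>R\<^esub> span_upto q n"

lemma span_upto_ideal:
  assumes "\<And>n. q n \<in> carrier R"
  shows "ideal (span_upto q n) R"
  by (induction n) (simp_all add: assms cgenideal_ideal add_ideals)

text \<open>Each \<open>q (Suc n)\<close> is \<open>b / a\<close> times \<open>q n\<close>, so a
  combination of \<open>q 0, ..., q n\<close> is \<open>q 0\<close> times a polynomial expression in
  \<open>b / a\<close>. The list \<open>cs\<close> may begin with zeros; its fixed length controls
  the exponent of a coefficient put in front.\<close>

lemma embed_span_upto: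
  assumes a: "a \<in> carrier R - {\<zero>}" and b: "b \<in> carrier R"
    and q: "\<And>n. q n \<in> carrier R" "\<And>n. a \<otimes> q (Suc n) = b \<otimes> q n"
  shows "embed (q n) = fraction R b a [^]\<^bsub>fraction_field R\<^esub> n \<otimes>\<^bsub>fraction_field R\<^esub> embed (q 0)"
    and "x \<in> span_upto q n \<Longrightarrow> \<exists>cs. set cs \<subseteq> fraction_base R \<and> length cs = Suc n \<and>
      embed x = ring.eval (fraction_field R) cs (fraction R b a) \<otimes>\<^bsub>fraction_field R\<^esub> embed (q 0)"
proof -
  define K \<xi> where "K = fraction_field R" and "\<xi> = fraction R b a"
  interpret K: field K unfolding K_def by (rule fraction_field_is_field)
  note embed = embed_closed[folded K_def] embed_simps[folded K_def]
  have \<xi>: "\<xi> \<in> carrier K" unfolding \<xi>_def K_def using a b by (rule fraction_closed[rotated])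
  have base: "fraction_base R \<subseteq> carrier K" using embed(1) by (auto simp: fraction_base_def)
  have pow: "embed (q n) = \<xi> [^]\<^bsub>K\<^esub> n \<otimes>\<^bsub>K\<^esub> embed (q 0)" for n
  proof (induction n)
    case 0
    then show ?case using embed(1) q(1) by simp
  next
    case (Suc n)
    have "embed (q (Suc n)) = \<xi> \<otimes>\<^bsub>K\<^esub> embed (q n)"
      unfolding \<xi>_def K_def using a b q nonzero_mult[of a \<one>]
      by (simp add: fraction_mult fraction_eq_iff m_comm)
    then show ?case using Suc \<xi> embed(1)[OF q(1)] by (simp add: K.m_ac)
  qed
  then show "embed (q n) = fraction R b a [^]\<^bsub>fraction_field R\<^esub> n \<otimes>\<^bsub>fraction_field R\<^esub> embed (q 0)"
    unfolding K_def \<xi>_def .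
  have "\<exists>cs. set cs \<subseteq> fraction_base R \<and> length cs = Suc n \<and> embed x = K.eval cs \<xi> \<otimes>\<^bsub>K\<^esub> embed (q 0)"
    if "x \<in> span_upto q n" for x
    using that
  proof (induction n arbitrary: x)
    case 0
    then obtain c where c: "c \<in> carrier R" "x = c \<otimes> q 0" by (auto simp: cgenideal_def)
    then show ?case
      using embed q(1) by (intro exI[of _ "[embed c]"]) (simp add: fraction_base_def)
  next
    case (Suc n)
    then obtain c y where c: "c \<in> carrier R" "x = c \<otimes> q (Suc n) \<oplus> y" and y: "y \<in> span_upto q n"
      by (auto simp: cgenideal_def set_add_def')
    have yR: "y \<in> carrier R" by (rule ideal.Icarr[OF span_upto_ideal[of q, OF q(1)] y])
    obtain cs where cs: "set cs \<subseteq> fraction_base R" "length cs = Suc n"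
      "embed y = K.eval cs \<xi> \<otimes>\<^bsub>K\<^esub> embed (q 0)"
      using Suc.IH[OF y] by blast
    have ev: "K.eval cs \<xi> \<in> carrier K" using cs(1) base \<xi> by (intro K.eval_in_carrier) auto
    have "embed x = embed c \<otimes>\<^bsub>K\<^esub> (\<xi> [^]\<^bsub>K\<^esub> Suc n \<otimes>\<^bsub>K\<^esub> embed (q 0)) \<oplus>\<^bsub>K\<^esub> K.eval cs \<xi> \<otimes>\<^bsub>K\<^esub> embed (q 0)"
      using c q(1) yR embed(2,3) pow[of "Suc n"] cs(3) by simp
    also have "\<dots> = K.eval (embed c # cs) \<xi> \<otimes>\<^bsub>K\<^esub> embed (q 0)"
      using \<xi> ev c(1) embed(1) q(1) cs(2) by (simp add: K.l_distr K.m_assoc)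
    finally show ?case
      using cs c(1) by (intro exI[of _ "embed c # cs"]) (auto simp: fraction_base_def)
  qed
  then show "x \<in> span_upto q n \<Longrightarrow> \<exists>cs. set cs \<subseteq> fraction_base R \<and> length cs = Suc n \<and>
      embed x = ring.eval (fraction_field R) cs (fraction R b a) \<otimes>\<^bsub>fraction_field R\<^esub> embed (q 0)"
    unfolding K_def \<xi>_def .
qed

end

context dedekind_domain
begin

text \<open>With \<open>\<xi> = b/a\<close> and \<open>0 \<noteq> p \<in> P\<close> all \<open>q n = \<xi>\<^sup>n p\<close> lie in \<open>P\<close>. Since the ideals generated by
  \<open>q 0, \<dots>, q n\<close> stabilise, dividing by \<open>p\<close> gives an integral equation for \<open>\<xi>\<close>.\<close>

lemma denominator_divides_if_stabilises_ideal:
  assumes a: "a \<in> carrier R - {\<zero>}" and b: "b \<in> carrier R"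
    and P: "ideal P R" "P \<noteq> {\<zero>}"
    and stab: "\<And>p. p \<in> P \<Longrightarrow> \<exists>p'\<in>P. a \<otimes> p' = b \<otimes> p"
  shows "b \<in> PIdl a"
proof -
  interpret P: ideal P R by fact
  obtain p where p: "p \<in> P" "p \<noteq> \<zero>" using P(2) P.zero_closed by blast
  define q where "q = rec_nat p (\<lambda>_ x. SOME y. y \<in> P \<and> a \<otimes> y = b \<otimes> x)"
  have some: "(SOME y. y \<in> P \<and> a \<otimes> y = b \<otimes> x) \<in> P \<and> a \<otimes> (SOME y. y \<in> P \<and> a \<otimes> y = b \<otimes> x) = b \<otimes> x"
    if "x \<in> P" for x
    using someI_ex[of "\<lambda>y. y \<in> P \<and> a \<otimes> y = b \<otimes> x"] stab[OF that] by blast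
  have qP: "q n \<in> P" for n by (induction n) (use p some in \<open>auto simp: q_def\<close>)
  then have q: "q n \<in> carrier R" for n by (simp add: P.Icarr)
  have step: "a \<otimes> q (Suc n) = b \<otimes> q n" for n using some[OF qP[of n]] by (simp add: q_def)
  have q0: "q 0 = p" by (simp add: q_def)
  have in_span: "q (Suc n) \<in> span_upto q (Suc n)" "span_upto q n \<subseteq> span_upto q (Suc n)" for n
  proof -
    interpret A: ideal "span_upto q n" R by (rule span_upto_ideal[of q, OF q])
    interpret B: ideal "PIdl (q (Suc n))" R by (rule cgenideal_ideal[OF q])
    have "q (Suc n) \<oplus> \<zero> \<in> PIdl (q (Suc n)) <+>\<^bsub>R\<^esub> span_upto q n"
      unfolding set_add_def' using cgenideal_self[OF q] A.zero_closed by blast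
    then show "q (Suc n) \<in> span_upto q (Suc n)" using q by simp
    have "\<zero> \<oplus> x \<in> PIdl (q (Suc n)) <+>\<^bsub>R\<^esub> span_upto q n" if "x \<in> span_upto q n" for x
      unfolding set_add_def' using that B.zero_closed by blast
    then show "span_upto q n \<subseteq> span_upto q (Suc n)" using A.Icarr by auto
  qed
  obtain n where "span_upto q (Suc n) = span_upto q n"
    using ascending_ideals_stabilise[of "span_upto q"] span_upto_ideal[of q, OF q] in_span(2) by blast
  then have "q (Suc n) \<in> span_upto q n" using in_span(1)[of n] by simp
  \<comment> \<open>With the negative, adding \<open>q (Suc n)\<close> gives zero and thereby a
    monic equation.\<close>
  then have mem: "\<ominus> q (Suc n) \<in> span_upto q n"
    by (rule additive_subgroup.a_inv_closed[OF ideal.axioms(1)[OF span_upto_ideal[of q, OF q]]])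
  define K \<xi> where "K = fraction_field R" and "\<xi> = fraction R b a"
  interpret K: field K unfolding K_def by (rule fraction_field_is_field)
  note embed = embed_closed[folded K_def] embed_simps[folded K_def]
  have \<xi>: "\<xi> \<in> carrier K" unfolding \<xi>_def K_def using a b by (rule fraction_closed[rotated])
  have base: "fraction_base R \<subseteq> carrier K" using embed(1) by (auto simp: fraction_base_def)
  obtain cs where cs: "set cs \<subseteq> fraction_base R" "length cs = Suc n"
    "embed (\<ominus> q (Suc n)) = K.eval cs \<xi> \<otimes>\<^bsub>K\<^esub> embed p"
    using embed_span_upto(2)[of a b q, OF a b q step mem] q0 by (auto simp: K_def \<xi>_def)
  have ev: "K.eval cs \<xi> \<in> carrier K" using cs(1) base \<xi> by (intro K.eval_in_carrier) auto
  have pR: "p \<in> carrier R" using p P.Icarr by blast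
  have "K.eval (\<one>\<^bsub>K\<^esub> # cs) \<xi> \<otimes>\<^bsub>K\<^esub> embed p = \<xi> [^]\<^bsub>K\<^esub> Suc n \<otimes>\<^bsub>K\<^esub> embed p \<oplus>\<^bsub>K\<^esub> K.eval cs \<xi> \<otimes>\<^bsub>K\<^esub> embed p"
    using \<xi> ev embed(1) pR cs(2) by (simp add: K.l_distr)
  also have "\<dots> = embed (q (Suc n)) \<oplus>\<^bsub>K\<^esub> embed (\<ominus> q (Suc n))"
    using embed_span_upto(1)[of a b q, OF a b q step] q0 cs(3) by (simp add: K_def \<xi>_def)
  also have "\<dots> = embed \<zero>"
    using embed(3)[of "q (Suc n)" "\<ominus> q (Suc n)"] q by (simp add: r_neg)
  also have "\<dots> = \<zero>\<^bsub>K\<^esub>"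
    by (simp add: K_def fraction_zero)
  finally have "K.eval (\<one>\<^bsub>K\<^esub> # cs) \<xi> = \<zero>\<^bsub>K\<^esub> \<or> embed p = \<zero>\<^bsub>K\<^esub>"
    using \<xi> base cs(1) embed(1) pR by (intro K.integral K.eval_in_carrier) auto
  moreover have "embed p \<noteq> \<zero>\<^bsub>K\<^esub>"
    using embed(4)[of p \<zero>] p(2) pR by (simp add: K_def fraction_zero)
  \<comment> \<open>The leading \<open>1\<close> makes the list a legal polynomial even if
    \<open>cs\<close> begins with zeros.\<close>
  moreover have "\<one>\<^bsub>K\<^esub> # cs \<in> carrier ((fraction_base R)[X]\<^bsub>K\<^esub>)"
    using cs(1) by (auto simp: univ_poly_def polynomial_def fraction_base_def K_def fraction_one)
      (metis K.one_not_zero K_def fraction_one)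
  ultimately have "integral_over K (fraction_base R) \<xi>"
    unfolding integral_over_def by (intro bexI[of _ "\<one>\<^bsub>K\<^esub> # cs"]) auto
  then have "\<xi> \<in> fraction_base R"
    using integrally_closed \<xi> by (simp add: K_def)
  then obtain c where c: "c \<in> carrier R" "fraction R b a = embed c"
    by (auto simp: fraction_base_def \<xi>_def)
  then have "b = c \<otimes> a" using a b by (simp add: fraction_eq_iff)
  then show ?thesis using c(1) by (auto simp: cgenideal_def)
qed

text \<open>An ideal maximal among the \<open>((a) : b)\<close> contained in \<open>P\<close> is prime, hence equal to \<open>P\<close>.\<close>

lemma prime_annihilates_modulo_principal:
  assumes "primeideal P R" and a: "a \<in> P" "a \<noteq> \<zero>"
  obtains b where "b \<in> carrier R" "b \<notin> PIdl a" "\<And>r. r \<in> P \<Longrightarrow> r \<otimes> b \<in> PIdl a"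
proof -
  interpret P: primeideal P R by fact
  have aR: "a \<in> carrier R" using a P.Icarr by blast
  interpret A: ideal "PIdl a" R by (rule cgenideal_ideal[OF aR])
  define C where "C = (\<lambda>b. {r \<in> carrier R. r \<otimes> b \<in> PIdl a})"
  have C_iff: "r \<in> C b \<longleftrightarrow> r \<in> carrier R \<and> r \<otimes> b \<in> PIdl a" for r b
    by (simp add: C_def)
  have C_ideal: "ideal (C b) R" if "b \<in> carrier R" for b
    using colon_ideal[OF A.is_ideal, of "{b}"] that by (simp add: C_def)
  have C_mono: "C b \<subseteq> C (s \<otimes> b)" if "b \<in> carrier R" "s \<in> carrier R" for b s
  proof
    fix r assume "r \<in> C b"
    then have r: "r \<in> carrier R" "r \<otimes> b \<in> PIdl a" by (auto simp: C_def)
    then have "r \<otimes> (s \<otimes> b) = s \<otimes> (r \<otimes> b)" using that by (simp add: m_lcomm)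
    then show "r \<in> C (s \<otimes> b)" using A.I_l_closed[OF r(2) that(2)] r(1) by (simp add: C_def)
  qed
  define F where "F = {C b | b. b \<in> carrier R \<and> C b \<subseteq> P}"
  have "C \<one> \<subseteq> P"
  proof
    fix r assume "r \<in> C \<one>"
    then have "r \<in> PIdl a" unfolding C_iff by (elim conjE) simp
    then show "r \<in> P" using cgenideal_minimal[OF P.is_ideal a(1)] by (rule subsetD[rotated])
  qed
  then have "F \<noteq> {}" by (auto simp: F_def)
  then obtain M where M: "M \<in> F" and max: "\<And>J. \<lbrakk>J \<in> F; M \<subseteq> J\<rbrakk> \<Longrightarrow> J = M"
    using exists_maximal_ideal_of_family[of F] C_ideal by (auto simp: F_def)
  obtain b where b: "b \<in> carrier R" "C b \<subseteq> P" "M = C b" using M by (auto simp: F_def)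
  have le: "C (s \<otimes> b) = C b" if "s \<in> carrier R" "C (s \<otimes> b) \<subseteq> P" for s
    using max[of "C (s \<otimes> b)"] C_mono[OF b(1) that(1)] that b by (auto simp: F_def)
  have "primeideal (C b) R"
  proof (rule primeidealI[OF C_ideal[OF b(1)] is_cring])
    show "carrier R \<noteq> C b" using b(2) P.I_notcarr P.Icarr by blast
    fix x y assume xy: "x \<in> carrier R" "y \<in> carrier R" "x \<otimes> y \<in> C b"
    show "x \<in> C b \<or> y \<in> C b"
    \<comment> \<open>In the first case maximality gives \<open>C (y b) = C b\<close>, which then
      contains \<open>x\<close>. Otherwise some \<open>s\<close> outside \<open>P\<close> has
      \<open>s y b\<close> in \<open>(a)\<close>; primality of \<open>P\<close> keeps
      \<open>C (s b)\<close> inside \<open>P\<close>, so it equals \<open>C b\<close>, and it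
      contains \<open>y\<close>.\<close>
    proof (cases "C (y \<otimes> b) \<subseteq> P")
      case True
      have "x \<in> C (y \<otimes> b)"
        using xy(3) m_assoc[OF xy(1,2) b(1)] xy(1) unfolding C_iff by argo
      then show ?thesis using le[OF xy(2) True] by simp
    next
      case False
      then obtain s where "s \<in> C (y \<otimes> b)" and "s \<notin> P" by auto
      then have s: "s \<in> carrier R" "s \<otimes> (y \<otimes> b) \<in> PIdl a" "s \<notin> P"
        by (simp_all add: C_iff)
      have "C (s \<otimes> b) \<subseteq> P"
      proof
        fix t assume t: "t \<in> C (s \<otimes> b)"
        then have tR: "t \<in> carrier R" "t \<otimes> (s \<otimes> b) \<in> PIdl a" by (simp_all add: C_iff)
        then have "t \<otimes> s \<in> C b" using m_assoc[OF tR(1) s(1) b(1)] s(1) unfolding C_iff by simp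
        then show "t \<in> P" using b(2) P.I_prime[OF tR(1) s(1)] s(3) by blast
      qed
      then have "C (s \<otimes> b) = C b" by (rule le[OF s(1)])
      moreover have "y \<in> C (s \<otimes> b)" 
        using s(2) m_lcomm[OF s(1) xy(2) b(1)] xy(2) unfolding C_iff by simp
      ultimately show ?thesis by simp
    qed
  qed
  \<comment> \<open>The element \<open>a\<close> shows that the prime \<open>C b\<close> is nonzero,
    hence maximal.\<close>
  moreover have aC: "a \<in> C b"
    using A.I_r_closed[OF cgenideal_self[OF aR] b(1)] aR by (simp add: C_def)
  ultimately have "maximalideal (C b) R" using prime_imp_maximal a(2) by blast
  then have "P = C b"
    using maximalideal.I_maximal[OF _ P.is_ideal b(2)] P.a_subset P.I_notcarr by blast
  moreover have "b \<notin> PIdl a"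
  proof
    assume "b \<in> PIdl a"
    then have "\<one> \<in> C b" using b(1) by (simp add: C_def)
    then show False using \<open>P = C b\<close> P.one_imp_carrier P.I_notcarr by simp
  qed
  ultimately show thesis using that[OF b(1)] C_iff by blast
qed

text \<open>With \<open>b P \<subseteq> (a)\<close> and \<open>b/a\<close> not integral, some \<open>s = b p0 / a\<close> is outside \<open>P\<close>, which makes \<open>P\<close>
  invertible. The cofactor of \<open>P\<close> in \<open>I\<close> is the colon ideal \<open>(I : P)\<close>.\<close>

lemma prime_contains_imp_dvd:
  assumes "primeideal P R" "P \<noteq> {\<zero>}" and I: "ideal I R" "I \<subseteq> P"
  shows "ideal_dvd R P I"
proof -
  interpret P: primeideal P R by fact
  interpret I: ideal I R by fact
  obtain a where a: "a \<in> P" "a \<noteq> \<zero>" using assms(2) P.zero_closed by blast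
  have aR: "a \<in> carrier R" using a P.Icarr by blast
  obtain b where b: "b \<in> carrier R" "b \<notin> PIdl a" and Pb: "\<And>p. p \<in> P \<Longrightarrow> p \<otimes> b \<in> PIdl a"
    using prime_annihilates_modulo_principal[OF assms(1) a] by blast
  have quot: "\<exists>s\<in>carrier R. a \<otimes> s = b \<otimes> p" if "p \<in> P" for p
  proof -
    have "p \<otimes> b \<in> PIdl a" "p \<in> carrier R" using Pb[OF that] P.Icarr[OF that] by auto
    then show ?thesis using aR b(1) by (auto simp: cgenideal_def m_comm)
  qed
  \<comment> \<open>Otherwise multiplication by \<open>b / a\<close> would map \<open>P\<close> into
    itself, and integral closedness would force \<open>b\<close> into \<open>(a)\<close>.\<close>
  have "\<not> (\<forall>p\<in>P. \<exists>p'\<in>P. a \<otimes> p' = b \<otimes> p)"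
    using denominator_divides_if_stabilises_ideal[of a b P] aR a(2) b P.is_ideal assms(2) by blast
  then obtain p0 s where p0: "p0 \<in> P" and s: "s \<in> carrier R" "s \<notin> P" "a \<otimes> s = b \<otimes> p0"
    using quot by blast
  have p0R: "p0 \<in> carrier R" using p0 P.Icarr by blast
  have "\<not> PIdl s \<subseteq> P" using cgenideal_self[OF s(1)] s(2) by blast
  then obtain p t where p: "p \<in> P" and t: "t \<in> PIdl s" and "\<one> = p \<oplus> t"
    using maximalideal_comaximal[OF prime_imp_maximal[OF assms(1,2)] cgenideal_ideal[OF s(1)]] by blast
  then obtain r where r: "r \<in> carrier R" and one: "\<one> = p \<oplus> r \<otimes> s"
    by (auto simp: cgenideal_def)
  have pR: "p \<in> carrier R" using p P.Icarr by blast
  define J where "J = {x \<in> carrier R. \<forall>y\<in>P. x \<otimes> y \<in> I}"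
  have J: "ideal J R" unfolding J_def by (rule colon_ideal[OF I(1) P.a_subset])
  have "P \<cdot> J \<subseteq> I"
  proof
    fix x assume "x \<in> P \<cdot> J"
    then show "x \<in> I"
      by induction (auto simp: J_def m_comm P.Icarr)
  qed
  moreover have "I \<subseteq> P \<cdot> J"
  proof
    fix i assume i: "i \<in> I"
    have iR: "i \<in> carrier R" using i I.Icarr by blast
    \<comment> \<open>\<open>c\<close> stands for \<open>b i / a\<close>. For \<open>y\<close> in
      \<open>P\<close> the product \<open>c y = i (b y / a)\<close> lies in \<open>I\<close>, so
      \<open>c\<close> is in \<open>J\<close>.\<close>
    obtain c where c: "c \<in> carrier R" "a \<otimes> c = b \<otimes> i" using quot i I(2) by blast
    have "c \<otimes> y \<in> I" if y: "y \<in> P" for y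
    proof -
      have yR: "y \<in> carrier R" using y P.Icarr by blast
      obtain d where d: "d \<in> carrier R" "a \<otimes> d = b \<otimes> y" using quot y by blast
      have "a \<otimes> (c \<otimes> y) = (a \<otimes> c) \<otimes> y" using aR c(1) yR by (simp add: m_assoc)
      also have "\<dots> = i \<otimes> (b \<otimes> y)" unfolding c(2) using b(1) yR iR by (simp add: m_ac)
      also have "\<dots> = i \<otimes> (a \<otimes> d)" by (simp add: d(2))
      also have "\<dots> = a \<otimes> (i \<otimes> d)" using aR d(1) iR by (simp add: m_ac)
      finally have "c \<otimes> y = i \<otimes> d" using m_lcancel[of a] aR a(2) c(1) yR iR d(1) by simp
      then show ?thesis using i d(1) I.I_r_closed by simp
    qed
    then have cJ: "c \<in> J" using c(1) by (simp add: J_def)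
    have iJ: "i \<in> J" using i iR I.I_r_closed P.Icarr by (auto simp: J_def)
    have "a \<otimes> (s \<otimes> i) = (a \<otimes> s) \<otimes> i" using aR s(1) iR by (simp add: m_assoc)
    also have "\<dots> = p0 \<otimes> (b \<otimes> i)" unfolding s(3) using b(1) p0R iR by (simp add: m_ac)
    also have "\<dots> = p0 \<otimes> (a \<otimes> c)" by (simp add: c(2))
    also have "\<dots> = a \<otimes> (p0 \<otimes> c)" using aR p0R c(1) by (simp add: m_ac)
    finally have si: "s \<otimes> i = p0 \<otimes> c" using m_lcancel[of a] aR a(2) c(1) s(1) iR p0R by simp
    \<comment> \<open>Multiplying \<open>1 = p + r s\<close> by \<open>i\<close> and using
      \<open>s i = p0 c\<close> writes \<open>i\<close> as a sum of two products from
      \<open>P\<close> and \<open>J\<close>.\<close>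
    have "i = (p \<oplus> r \<otimes> s) \<otimes> i" using iR one by (metis l_one)
    also have "\<dots> = p \<otimes> i \<oplus> r \<otimes> (s \<otimes> i)" using r s(1) pR iR by (simp add: l_distr m_assoc)
    also have "\<dots> = p \<otimes> i \<oplus> (r \<otimes> p0) \<otimes> c" using r p0R c(1) by (simp add: si m_assoc)
    finally have "i = p \<otimes> i \<oplus> (r \<otimes> p0) \<otimes> c" .
    moreover have "p \<otimes> i \<oplus> (r \<otimes> p0) \<otimes> c \<in> P \<cdot> J"
      using r p0 p cJ iJ by (intro ideal_prod.sum ideal_prod.prod P.I_l_closed)
    ultimately show "i \<in> P \<cdot> J" by simp
  qed
  ultimately show ?thesis unfolding ideal_dvd_def using J by blast
qed

end

section \<open>Ideals of index two in \<open>R\<close> and in \<open>R / I\<close>\<close>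

text \<open>The correspondence theorem handles all ideals. Index two is preserved because the
  criterion \<open>card_quot_eq_two_iff\<close> translates elementwise, which replaces the third
  isomorphism theorem.\<close>

lemma (in cring) bij_betw_index_two_ideals_quot:
  assumes "ideal I R"
  shows "bij_betw (\<lambda>J. (+>) I ` J) {J \<in> index_two_ideals. I \<subseteq> J} (cring.index_two_ideals (R Quot I))"
proof -
  interpret I: ideal I R by fact
  have carr: "carrier (R Quot I) = (\<lambda>x. I +> x) ` carrier R"
    by (auto simp: FactRing_def A_RCOSETS_def')
  interpret Q: cring "R Quot I" by (rule I.quotient_is_cring[OF is_cring])
  interpret h: ring_hom_ring R "R Quot I" "(+>) I" by (rule I.rcos_ring_hom_ring)
  let ?A = "{J. ideal J R \<and> I \<subseteq> J}"
  have iff: "card (carrier (R Quot J)) = 2 \<longleftrightarrow> card (carrier (R Quot I Quot ((+>) I ` J))) = 2"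
    if J: "ideal J R" "I \<subseteq> J" for J
  proof -
    interpret J: ideal J R by fact
    \<comment> \<open>\<open>J\<close> contains \<open>I\<close>, so it is a union of cosets of
      \<open>I\<close>.\<close>
    have mem: "I +> x \<in> (+>) I ` J \<longleftrightarrow> x \<in> J" if x: "x \<in> carrier R" for x
    proof
      assume "I +> x \<in> (+>) I ` J"
      then obtain j where j: "j \<in> J" "I +> x = I +> j" by blast
      then have "x \<ominus> j \<in> J"
        using quotient_eq_iff_same_a_r_cos[OF assms x J.Icarr] J(2) by blast
      then have "(x \<ominus> j) \<oplus> j \<in> J" using j(1) by (rule J.a_closed)
      moreover have "(x \<ominus> j) \<oplus> j = x" using x J.Icarr[OF j(1)] by algebra
      ultimately show "x \<in> J" by simp
    qed blast
    have minus: "(I +> x) \<ominus>\<^bsub>R Quot I\<^esub> \<one>\<^bsub>R Quot I\<^esub> = I +> (x \<ominus> \<one>)" if "x \<in> carrier R" for x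
      using that h.hom_add[of x "\<ominus> \<one>"] by (simp add: a_minus_def)
    show ?thesis
      unfolding card_quot_eq_two_iff[OF J(1)]
        Q.card_quot_eq_two_iff[OF ring_ideal_imp_quot_ideal[OF assms J(1)]] carr
      using mem[OF one_closed] by (simp add: minus mem)
  qed
  have bij: "bij_betw (\<lambda>J. (+>) I ` J) ?A {J. ideal J (R Quot I)}"
    by (rule quot_ideal_correspondence[OF assms])
  have "(\<lambda>J. (+>) I ` J) ` {J \<in> index_two_ideals. I \<subseteq> J} = Q.index_two_ideals"
  proof (intro equalityI subsetI)
    fix K assume "K \<in> (\<lambda>J. (+>) I ` J) ` {J \<in> index_two_ideals. I \<subseteq> J}"
    then show "K \<in> Q.index_two_ideals"
      using iff ring_ideal_imp_quot_ideal[OF assms]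
      by (auto simp: index_two_ideals_def Q.index_two_ideals_def)
  next
    fix K assume K: "K \<in> Q.index_two_ideals"
    then have "K \<in> (\<lambda>J. (+>) I ` J) ` ?A"
      using bij_betw_imp_surj_on[OF bij] by (auto simp: Q.index_two_ideals_def)
    then obtain J where "ideal J R" "I \<subseteq> J" "K = (+>) I ` J" by blast
    then show "K \<in> (\<lambda>J. (+>) I ` J) ` {J \<in> index_two_ideals. I \<subseteq> J}"
      using K iff by (auto simp: index_two_ideals_def Q.index_two_ideals_def)
  qed
  then show ?thesis
    by (rule bij_betw_subset[OF bij, rotated]) (auto simp: index_two_ideals_def)
qed

text \<open>Ideals of index two are maximal, hence prime, and for a nonzero prime dividing
  \<open>I\<close> is the same as containing it.\<close>

lemma (in dedekind_domain) index_two_prime_divisors: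
  assumes "ideal I R" "I \<noteq> {\<zero>}"
  shows "{P. primeideal P R \<and> ideal_dvd R P I \<and> card (carrier (R Quot P)) = 2}
    = {J \<in> index_two_ideals. I \<subseteq> J}"
proof (intro equalityI subsetI)
  fix P assume P: "P \<in> {P. primeideal P R \<and> ideal_dvd R P I \<and> card (carrier (R Quot P)) = 2}"
  then have id: "ideal P R" by (auto dest: primeideal.axioms(1))
  moreover obtain J where "ideal J R" "I = P \<cdot> J" using P by (auto simp: ideal_dvd_def)
  then have "I \<subseteq> P" using ideal_prod_inter[OF id] by blast
  ultimately show "P \<in> {J \<in> index_two_ideals. I \<subseteq> J}" using P by (simp add: index_two_ideals_def)
next
  fix P assume P: "P \<in> {J \<in> index_two_ideals. I \<subseteq> J}"
  interpret I: ideal I R by fact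
  have "primeideal P R" using maximalideal_prime[OF index_two_maximal] P by simp
  moreover have "P \<noteq> {\<zero>}" using P assms(2) I.zero_closed by blast
  ultimately have "ideal_dvd R P I" using prime_contains_imp_dvd assms(1) P by simp
  then show "P \<in> {P. primeideal P R \<and> ideal_dvd R P I \<and> card (carrier (R Quot P)) = 2}"
    using \<open>primeideal P R\<close> P by (simp add: index_two_ideals_def)
qed

theorem theorem6p2:
  fixes R (structure) and I :: "'a set" and m :: nat
  assumes "dedekind_domain R"
    and "ideal I R" and "I \<noteq> {\<zero>}"
    and "finite (carrier (R Quot I))"
    and "carrier (R Quot I) \<noteq> {\<zero>\<^bsub>R Quot I\<^esub>}"
    and "m > 0"
    and "card {P. primeideal P R \<and> ideal_dvd R P I \<and> card (carrier (R Quot P)) = 2} = m"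
  shows "card (pre_digraph.sccs (unitary_cayley_graph (R Quot I))) = 2 ^ (m - 1)
    \<and> (\<forall>H \<in> pre_digraph.sccs (unitary_cayley_graph (R Quot I)).
         bipartite H \<and> diameter H \<le> 3)
    \<and> (\<forall>H \<in> pre_digraph.sccs (unitary_cayley_graph (R Quot I)).
       \<forall>K \<in> pre_digraph.sccs (unitary_cayley_graph (R Quot I)). digraph_iso H K)"
proof -
  interpret dedekind_domain R by fact
  interpret I: ideal I R by fact
  interpret Q: cring "R Quot I" by (rule I.quotient_is_cring[OF is_cring])
  interpret Q: finite_cring "R Quot I" by unfold_locales (use assms(4,5) in auto)
  have "card Q.index_two_ideals = card {J \<in> index_two_ideals. I \<subseteq> J}"
    using bij_betw_same_card[OF bij_betw_index_two_ideals_quot[OF assms(2)]] by simp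
  then have card: "card Q.index_two_ideals = m"
    using assms(7) index_two_prime_divisors[OF assms(2,3)] by simp
  \<comment> \<open>Positivity of \<open>m\<close> supplies the ideal \<open>N\<close> on which the
    count and the bipartition rest.\<close>
  then have "Q.index_two_ideals \<noteq> {}"
    using assms(6) by auto
  then show ?thesis
    using Q.card_sccs Q.bipartite_component Q.diameter_component Q.components_isomorphic card
    unfolding Q.sccs_eq by auto
qed

end
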